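(* Let $\beta=(\beta_1,\ldots,\beta_s)$ be a composition with $s=2\ell+1$ parts, and let $k$ be an integer with $0\le k\le\min\{\beta_1,\beta_s\}$. Then the map $\Phi$ defined by steps (PH1)–(PH3) below is a well-defined bijection from the set $\mathcal{I}_k(\beta)$ of lower order ideals of the fence $F(\beta)$ with $k$ elements to the set $\mathcal{U}_k(\beta)$ of upper order ideals (filters) of $F(\beta)$ with $k$ elements.
   Context: The fence $F(\beta)$ is obtained from chains $S_1,\dots,S_s$ with $\#S_i=\beta_i+1$ by identifying the maximal elements of $S_i,S_{i+1}$ for $i$ odd and the minimal elements for $i$ even. Its ascending segments are $A_j=S_{2j-1}$ ($1\le j\le\ell+1$) and descending segments $D_i=S_{2i}$ ($1\le i\le\ell$). An element is shared if it lies on two segments. Let $\tilde A_j$ be the set of unshared elements of $A_j$, $\alpha_j=1+\#\tilde A_j$ (so $\alpha_1=\beta_1+1$, $\alpha_{\ell+1}=\beta_s+1$, $\alpha_j=\beta_{2j-1}$ otherwise), and $\delta_i=\beta_{2i}$, so $\#D_i=\delta_i+1$; the sets $\tilde A_j$ and $D_i$ partition $F(\beta)$. A lower order ideal $I$ is encoded by $a_j=\#(I\cap\tilde A_j)$, $d_i=\#(I\cap D_i)$; a filter $U$ is encoded by $b_j=\#(U\cap\tilde A_j)$, $e_i=\#(U\cap D_i)$; these encodings determine $I$ and $U$. The map $\phi$ on finite sequences of nonnegative integers: a block is a maximal run of consecutive positive entries; the trailing ones $T$ of a block $B$ is its maximal (possibly empty) final segment of ones, and $B'$ is $B$ with $T$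 removed. (P1) for each block with nonempty $T$, exchange $T$ with the entry $0$ immediately following it; (P2) for each block with $\#B'\ge2$, decrease the last entry of $B'$ by $1$ and increase the first entry of $B'$ by $1$. ($\phi$ is applicable when every nonempty $T$ is immediately followed by a $0$.) Given $I$ encoded by $(a,d)$, $\Phi(I)$ is computed as follows. (PH1) For every $i\in[\ell]$ with $d_i=1$ and $a_{i+1}<\alpha_{i+1}-1$, set $d_i:=0$ and $a_{i+1}:=a_{i+1}+1$. (PH2) Split $d_1,\ldots,d_\ell$ into factors by cutting between $d_{i-1}$ and $d_i$ for each $i\in[2,\ell]$ with $a_i<\alpha_i-1$; apply $\phi$ to each factor and concatenate the results to get $e$; set $b:=a$. (PH3) For every $i\in[\ell]$ with $e_i=0$ and $b_i>0$, set $e_i:=1$ and $b_i:=b_i-1$. Then $\Phi(I)$ is the filter encoded by $(b,e)$. *)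

theory Defs
  imports Main
begin

text \<open>
  A composition is a list \<open>\<beta>\<close> of positive naturals; part \<open>\<beta>\<^sub>i\<close> is \<open>\<beta> ! (i - 1)\<close>. Segments, the
  encodings \<open>a\<close>, \<open>d\<close>, \<open>b\<close>, \<open>e\<close> and the sizes \<open>\<alpha>\<close> are indexed from 1.

  The elements of \<open>F(\<beta>)\<close> are the positions \<open>0, \<dots>, \<beta>\<^sub>1 + \<dots> + \<beta>\<^sub>s\<close> along the fence, read from
  left to right. Consecutive segments overlap in exactly one position, which is the identified
  element.
\<close>

definition seg :: "nat list \<Rightarrow> nat \<Rightarrow> nat set" where
  "seg \<beta> i = {sum_list (take (i - 1) \<beta>) .. sum_list (take i \<beta>)}"

definition fence :: "nat list \<Rightarrow> nat set" where
  "fence \<beta> = (\<Union>i\<in>{1..length \<beta>}. seg \<beta> i)"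

text \<open>
  Odd segments ascend and even segments descend from left to right. The union of the chain orders
  is already transitive, as segments are glued only at two maxima or at two minima (see
  \<open>partial_order_on_fence\<close>).
\<close>

definition fence_order :: "nat list \<Rightarrow> nat rel" where
  "fence_order \<beta> = {(x, y). \<exists>i\<in>{1..length \<beta>}.
     x \<in> seg \<beta> i \<and> y \<in> seg \<beta> i \<and> (if odd i then x \<le> y else y \<le> x)}"

definition lower_ideal :: "nat list \<Rightarrow> nat set \<Rightarrow> bool" where
  "lower_ideal \<beta> I \<longleftrightarrow> I \<subseteq> fence \<beta> \<and> (\<forall>(x, y)\<in>fence_order \<beta>. y \<in> I \<longrightarrow> x \<in> I)"

definition upper_ideal :: "nat list \<Rightarrow> nat set \<Rightarrow> bool" where
  "upper_ideal \<beta> U \<longleftrightarrow> U \<subseteq> fence \<beta> \<and> (\<forall>(x, y)\<in>fence_order \<beta>. x \<in> U \<longrightarrow> y \<in> U)"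

definition ideals :: "nat list \<Rightarrow> nat \<Rightarrow> nat set set" where
  "ideals \<beta> k = {I. lower_ideal \<beta> I \<and> card I = k}"

definition filters :: "nat list \<Rightarrow> nat \<Rightarrow> nat set set" where
  "filters \<beta> k = {U. upper_ideal \<beta> U \<and> card U = k}"

definition shared :: "nat list \<Rightarrow> nat \<Rightarrow> bool" where
  "shared \<beta> x \<longleftrightarrow> (\<exists>i\<in>{1..length \<beta>}. \<exists>j\<in>{1..length \<beta>}. i \<noteq> j \<and> x \<in> seg \<beta> i \<and> x \<in> seg \<beta> j)"

definition unshared_asc :: "nat list \<Rightarrow> nat \<Rightarrow> nat set" where
  "unshared_asc \<beta> j = {x \<in> seg \<beta> (2 * j - 1). \<not> shared \<beta> x}"

definition desc :: "nat list \<Rightarrow> nat \<Rightarrow> nat set" where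
  "desc \<beta> i = seg \<beta> (2 * i)"

definition ell :: "nat list \<Rightarrow> nat" where
  "ell \<beta> = length \<beta> div 2"

definition alpha :: "nat list \<Rightarrow> nat \<Rightarrow> nat" where
  "alpha \<beta> j = 1 + card (unshared_asc \<beta> j)"

text \<open>An encoding is a pair of functions of which only the values on \<open>{1..\<ell>+1}\<close> and \<open>{1..\<ell>}\<close>,
  respectively, are meaningful.\<close>

type_synonym code = "(nat \<Rightarrow> nat) \<times> (nat \<Rightarrow> nat)"

definition encode :: "nat list \<Rightarrow> nat set \<Rightarrow> code" where
  "encode \<beta> X = (\<lambda>j. card (X \<inter> unshared_asc \<beta> j), \<lambda>i. card (X \<inter> desc \<beta> i))"

definition encoded_by :: "nat list \<Rightarrow> nat set \<Rightarrow> code \<Rightarrow> bool" where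
  "encoded_by \<beta> X c \<longleftrightarrow>
     (\<forall>j\<in>{1..ell \<beta> + 1}. fst (encode \<beta> X) j = fst c j) \<and>
     (\<forall>i\<in>{1..ell \<beta>}. snd (encode \<beta> X) i = snd c i)"

text \<open>\<open>block us B vs\<close>: the factor \<open>B\<close> of \<open>us @ B @ vs\<close> is a maximal run of positive entries.\<close>

definition block :: "nat list \<Rightarrow> nat list \<Rightarrow> nat list \<Rightarrow> bool" where
  "block us B vs \<longleftrightarrow> B \<noteq> [] \<and> (\<forall>x\<in>set B. 0 < x) \<and>
     (us = [] \<or> last us = 0) \<and> (vs = [] \<or> hd vs = 0)"

definition trailing_ones :: "nat list \<Rightarrow> nat list" where
  "trailing_ones B = rev (takeWhile (\<lambda>x. x = 1) (rev B))"

definition stem :: "nat list \<Rightarrow> nat list" where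
  "stem B = rev (dropWhile (\<lambda>x. x = 1) (rev B))"

definition phi_applicable :: "nat list \<Rightarrow> bool" where
  "phi_applicable xs \<longleftrightarrow> (\<forall>us B vs. xs = us @ B @ vs \<and> block us B vs \<and> trailing_ones B \<noteq> [] \<longrightarrow>
     (\<exists>ws. vs = 0 # ws))"

definition shift_stem :: "nat list \<Rightarrow> nat list" where
  "shift_stem S = (if 2 \<le> length S
     then S[0 := hd S + 1, length S - 1 := last S - 1] else S)"

text \<open>
  \<open>phi\<close> processes the blocks from left to right: a block \<open>B = stem B @ trailing_ones B\<close> with
  nonempty trailing ones is followed by an entry 0 (dropped by \<open>tl\<close>), which moves in front of the
  trailing ones. The value is irrelevant when \<open>phi_applicable\<close> fails.
\<close>

function phi :: "nat list \<Rightarrow> nat list" where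
  "phi [] = []"
| "phi (0 # xs) = 0 # phi xs"
| "phi (Suc n # xs) =
    (let B = Suc n # takeWhile (\<lambda>x. 0 < x) xs; R = dropWhile (\<lambda>x. 0 < x) xs
     in shift_stem (stem B) @
        (if trailing_ones B = [] then phi R else 0 # trailing_ones B @ phi (tl R)))"
  by pat_completeness auto
termination
proof (relation "measure length")
  fix n and xs :: "nat list"
  have "length (dropWhile (\<lambda>x. 0 < x) xs) \<le> length xs"
    by (rule length_dropWhile_le)
  then show "\<And>B R. B = Suc n # takeWhile (\<lambda>x. 0 < x) xs \<Longrightarrow> R = dropWhile (\<lambda>x. 0 < x) xs \<Longrightarrow>
      (R, Suc n # xs) \<in> measure length"
    and "\<And>B R. B = Suc n # takeWhile (\<lambda>x. 0 < x) xs \<Longrightarrow> R = dropWhile (\<lambda>x. 0 < x) xs \<Longrightarrow>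
      (tl R, Suc n # xs) \<in> measure length"
    by auto
qed simp_all

text \<open>\<open>factors C is\<close> splits a list of indices before each non-initial \<open>i\<close> with \<open>C i\<close>.\<close>

fun factors :: "(nat \<Rightarrow> bool) \<Rightarrow> nat list \<Rightarrow> nat list list" where
  "factors C [] = []"
| "factors C [i] = [[i]]"
| "factors C (i # j # is) =
    (if C j then [i] # factors C (j # is)
     else (i # hd (factors C (j # is))) # tl (factors C (j # is)))"

definition PH1 :: "nat list \<Rightarrow> code \<Rightarrow> code" where
  "PH1 \<beta> = (\<lambda>(a, d).
     let P = (\<lambda>i. i \<in> {1..ell \<beta>} \<and> d i = 1 \<and> a (i + 1) < alpha \<beta> (i + 1) - 1)
     in (\<lambda>j. if 2 \<le> j \<and> P (j - 1) then a j + 1 else a j, \<lambda>i. if P i then 0 else d i))"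

definition PH2_factors :: "nat list \<Rightarrow> code \<Rightarrow> nat list list" where
  "PH2_factors \<beta> = (\<lambda>(a, d).
     map (map d) (factors (\<lambda>i. a i < alpha \<beta> i - 1) [1..<ell \<beta> + 1]))"

definition PH2 :: "nat list \<Rightarrow> code \<Rightarrow> code" where
  "PH2 \<beta> c = (fst c, \<lambda>i. concat (map phi (PH2_factors \<beta> c)) ! (i - 1))"

definition PH3 :: "nat list \<Rightarrow> code \<Rightarrow> code" where
  "PH3 \<beta> = (\<lambda>(b, e).
     let P = (\<lambda>i. i \<in> {1..ell \<beta>} \<and> e i = 0 \<and> 0 < b i)
     in (\<lambda>j. if P j then b j - 1 else b j, \<lambda>i. if P i then 1 else e i))"

definition Phi_code :: "nat list \<Rightarrow> nat set \<Rightarrow> code" where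
  "Phi_code \<beta> I = PH3 \<beta> (PH2 \<beta> (PH1 \<beta> (encode \<beta> I)))"

definition Phi :: "nat list \<Rightarrow> nat set \<Rightarrow> nat set" where
  "Phi \<beta> I = (THE U. upper_ideal \<beta> U \<and> encoded_by \<beta> U (Phi_code \<beta> I))"

text \<open>The recipe for \<open>\<Phi>\<close> makes sense at \<open>I\<close>: \<open>\<phi>\<close> is applicable to every factor, the concatenated
  result has an entry for each of \<open>e\<^sub>1, \<dots>, e\<^sub>\<ell>\<close>, and the final \<open>(b, e)\<close> encodes exactly one
  filter.\<close>

definition Phi_defined :: "nat list \<Rightarrow> nat set \<Rightarrow> bool" where
  "Phi_defined \<beta> I \<longleftrightarrow>
     (\<forall>xs\<in>set (PH2_factors \<beta> (PH1 \<beta> (encode \<beta> I))). phi_applicable xs) \<and>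
     length (concat (map phi (PH2_factors \<beta> (PH1 \<beta> (encode \<beta> I))))) = ell \<beta> \<and>
     (\<exists>!U. upper_ideal \<beta> U \<and> encoded_by \<beta> U (Phi_code \<beta> I))"

lemma sum_list_take_less:
  assumes pos: "\<forall>x\<in>set \<beta>. 0 < x" and "i < j" "j \<le> length \<beta>"
  shows "sum_list (take i \<beta>) < (sum_list (take j \<beta>) :: nat)"
  using assms(2,3)
proof (induction j)
  case 0
  then show ?case by simp
next
  case (Suc j)
  have "sum_list (take (Suc j) \<beta>) = sum_list (take j \<beta>) + \<beta> ! j" "0 < \<beta> ! j"
    using Suc.prems pos by (simp_all add: take_Suc_conv_app_nth)
  with Suc show ?case by (cases "i = j") auto
qed

lemma seg_inter:
  assumes pos: "\<forall>x\<in>set \<beta>. 0 < x" and "1 \<le> i" "i < j" "j \<le> length \<beta>"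
    and y: "y \<in> seg \<beta> i" "y \<in> seg \<beta> j"
  shows "j = Suc i" "y = sum_list (take i \<beta>)"
proof -
  have yy: "y \<le> sum_list (take i \<beta>)" "sum_list (take (j - 1) \<beta>) \<le> y"
    using y by (auto simp: seg_def)
  show j: "j = Suc i"
  proof (rule ccontr)
    assume "j \<noteq> Suc i"
    with assms have "sum_list (take i \<beta>) < sum_list (take (j - 1) \<beta>)"
      by (intro sum_list_take_less) auto
    with yy show False by simp
  qed
  show "y = sum_list (take i \<beta>)"
    using yy j by simp
qed

lemma fence_order_meet:
  assumes pos: "\<forall>x\<in>set \<beta>. 0 < x" and ij: "i \<in> {1..length \<beta>}" "j \<in> {1..length \<beta>}"
    and xy: "x \<in> seg \<beta> i" "y \<in> seg \<beta> i" "if odd i then x \<le> y else y \<le> x"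
    and yz: "y \<in> seg \<beta> j" "z \<in> seg \<beta> j" "if odd j then y \<le> z else z \<le> y"
  shows "i = j \<or> x = y \<or> y = z"
proof (cases i j rule: linorder_cases)
  case less
  with seg_inter[OF pos _ less _ xy(2) yz(1)] ij
  have "j = Suc i" "y = sum_list (take i \<beta>)" by auto
  with xy yz show ?thesis by (cases "odd i") (auto simp: seg_def)
next
  case greater
  with seg_inter[OF pos _ greater _ yz(1) xy(2)] ij
  have "i = Suc j" "y = sum_list (take j \<beta>)" by auto
  with xy yz show ?thesis by (cases "odd i") (auto simp: seg_def)
qed simp

lemma partial_order_on_fence:
  assumes pos: "\<forall>x\<in>set \<beta>. 0 < x"
  shows "partial_order_on (fence \<beta>) (fence_order \<beta>)"
proof -
  have "refl_on (fence \<beta>) (fence_order \<beta>)" "fence_order \<beta> \<subseteq> fence \<beta> \<times> fence \<beta>"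
    by (auto simp: refl_on_def fence_def fence_order_def)
  moreover have "trans (fence_order \<beta>)"
  proof (rule transI)
    fix x y z
    assume xy: "(x, y) \<in> fence_order \<beta>" and yz: "(y, z) \<in> fence_order \<beta>"
    from xy obtain i where i: "i \<in> {1..length \<beta>}" "x \<in> seg \<beta> i" "y \<in> seg \<beta> i"
      "if odd i then x \<le> y else y \<le> x" by (auto simp: fence_order_def)
    from yz obtain j where j: "j \<in> {1..length \<beta>}" "y \<in> seg \<beta> j" "z \<in> seg \<beta> j"
      "if odd j then y \<le> z else z \<le> y" by (auto simp: fence_order_def)
    from fence_order_meet[OF pos i(1) j(1) i(2-4) j(2-4)]
    consider "i = j" | "x = y" | "y = z" by blast
    then show "(x, z) \<in> fence_order \<beta>"
    proof cases
      case 1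
      with i j show ?thesis
        unfolding fence_order_def by (auto intro!: bexI[of _ j] split: if_splits)
    qed (use xy yz in auto)
  qed
  moreover have "antisym (fence_order \<beta>)"
  proof (rule antisymI)
    fix x y
    assume xy: "(x, y) \<in> fence_order \<beta>" and yx: "(y, x) \<in> fence_order \<beta>"
    from xy obtain i where i: "i \<in> {1..length \<beta>}" "x \<in> seg \<beta> i" "y \<in> seg \<beta> i"
      "if odd i then x \<le> y else y \<le> x" by (auto simp: fence_order_def)
    from yx obtain j where j: "j \<in> {1..length \<beta>}" "y \<in> seg \<beta> j" "x \<in> seg \<beta> j"
      "if odd j then y \<le> x else x \<le> y" by (auto simp: fence_order_def)
    from fence_order_meet[OF pos i(1) j(1) i(2-4) j(2-4)] i(4) j(4)
    show "x = y" by (auto split: if_splits)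
  qed
  ultimately show ?thesis
    by (simp add: partial_order_on_def preorder_on_def)
qed

end

theory Submission
  imports Defs
begin

text \<open>
  Each of the three steps is injective. (PH1) moves a single element out of \<open>D\<^sub>i\<close>, which an ideal
  code reveals afterwards by \<open>d\<^sub>i = 0 < a\<^sub>i\<^sub>+\<^sub>1\<close>, and (PH3) is its mirror image. Writing a word as
  \<open>S\<^sub>1 T\<^sub>1 0 S\<^sub>2 T\<^sub>2 0 \<dots> 0 S\<^sub>m\<close>, where the \<open>T\<^sub>r\<close> consist of ones and no \<open>S\<^sub>r\<close> ends in a one, \<open>\<phi>\<close>
  yields \<open>S\<^sub>1' 0 T\<^sub>1 S\<^sub>2' 0 T\<^sub>2 \<dots> S\<^sub>m'\<close>, where no \<open>S\<^sub>r'\<close> starts with a one, so the factorization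
  can be read off the image. The bound on \<open>k\<close> excludes \<open>d\<^sub>1 = \<delta>\<^sub>1 + 1\<close> and a full last ascending
  segment; hence no factor ends in a one and \<open>\<phi>\<close> is applicable.

  Thus \<open>\<Phi>\<close> embeds the ideals of size \<open>k\<close> into the filters of size \<open>k\<close>. Rotating the fence by 180
  degrees turns filters of \<open>F(\<beta>)\<close> into ideals of the fence of the reversed composition, so the
  same embedding for the latter gives the opposite inequality of cardinalities.
\<close>

section \<open>The map \<open>\<phi>\<close>\<close>

definition is_stem :: "nat list \<Rightarrow> bool" where
  "is_stem S \<longleftrightarrow> (\<forall>x\<in>set S. 0 < x) \<and> (S = [] \<or> 2 \<le> last S)"

text \<open>In the rule \<open>split\<close>, \<open>S @ T\<close> may be empty, so the words are cut at every entry 0 and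
  \<open>\<phi>\<close> sends \<open>S @ T @ 0 # R\<close> to \<open>shift_stem S @ 0 # T @ phi R\<close> uniformly.\<close>

inductive phi_word :: "nat list \<Rightarrow> bool" where
  stem: "is_stem S \<Longrightarrow> phi_word S"
| split: "is_stem S \<Longrightarrow> \<forall>x\<in>set T. x = 1 \<Longrightarrow> phi_word R \<Longrightarrow> phi_word (S @ T @ 0 # R)"

lemma stem_append_trailing_ones: "stem B @ trailing_ones B = B"
  by (metis rev_append rev_rev_ident stem_def takeWhile_dropWhile_id trailing_ones_def)

lemma set_trailing_ones: "x \<in> set (trailing_ones B) \<Longrightarrow> x = 1"
  by (auto simp: trailing_ones_def dest: set_takeWhileD)

lemma is_stem_stem:
  assumes "\<forall>x\<in>set B. 0 < x"
  shows "is_stem (stem B)"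
proof -
  have "set (stem B) \<subseteq> set B"
    by (auto simp: stem_def dest: set_dropWhileD)
  moreover have "last (stem B) \<noteq> 1" if "stem B \<noteq> []"
    using that hd_dropWhile[of "\<lambda>x. x = 1" "rev B"] by (simp add: stem_def last_rev)
  ultimately show ?thesis
    using assms last_in_set[of "stem B"] unfolding is_stem_def
    by (metis One_nat_def Suc_1 Suc_leI le_neq_implies_less subsetD)
qed

text \<open>Cut at the first 0: the prefix is positive and splits into its stem and its trailing
  ones, and the remainder inherits the hypothesis. Only the final piece has no 0 after it, so it
  must be a stem, which the condition on the last entry ensures.\<close>

lemma phi_wordI: "xs = [] \<or> last xs \<noteq> 1 \<Longrightarrow> phi_word xs"
proof (induction xs rule: length_induct)
  case (1 xs)
  show ?case
  proof (cases "0 \<in> set xs")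
    case True
    then obtain B R where xs: "xs = B @ 0 # R" "0 \<notin> set B"
      by (meson split_list_first)
    then have "\<forall>x\<in>set B. 0 < x" by (auto intro: gr0I)
    moreover have "phi_word R"
      using 1 xs by (cases "R = []") (auto simp: is_stem_def intro: phi_word.stem)
    ultimately have "phi_word (stem B @ trailing_ones B @ 0 # R)"
      by (intro phi_word.split is_stem_stem) (auto dest: set_trailing_ones)
    then show ?thesis
      using stem_append_trailing_ones[of B] xs by (metis append_assoc)
  next
    case False
    then have "\<forall>x\<in>set xs. 0 < x" by (auto intro: gr0I)
    with 1(2) have "is_stem xs"
      using last_in_set[of xs] unfolding is_stem_def
      by (metis One_nat_def Suc_1 Suc_leI le_neq_implies_less)
    then show ?thesis by (rule phi_word.stem)
  qed
qed

text \<open>Trailing ones make a block end in 1, so by the hypothesis the block is not at the end of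
  the word, and its maximality makes the next entry 0.\<close>

lemma phi_applicableI:
  assumes "xs = [] \<or> last xs \<noteq> 1"
  shows "phi_applicable xs"
  unfolding phi_applicable_def
proof (intro allI impI, elim conjE)
  fix us B vs
  assume xs: "xs = us @ B @ vs" and "block us B vs" and T: "trailing_ones B \<noteq> []"
  then have vs: "vs = [] \<or> hd vs = 0" and "B \<noteq> []" by (auto simp: block_def)
  have "last B = 1"
    using T stem_append_trailing_ones[of B] set_trailing_ones[of "last B" B]
    by (metis last_appendR last_in_set)
  with assms xs \<open>B \<noteq> []\<close> have "vs \<noteq> []" by auto
  with vs show "\<exists>ws. vs = 0 # ws" by (cases vs) auto
qed

text \<open>Uniqueness of the decomposition of a block; it allows evaluating \<open>phi\<close> on
  any given factorization into a stem and ones.\<close>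

lemma trailing_ones_append:
  assumes "is_stem S" "\<forall>x\<in>set T. x = 1"
  shows "trailing_ones (S @ T) = T" "stem (S @ T) = S"
proof -
  have S: "S = [] \<or> hd (rev S) \<noteq> 1"
    using assms(1) by (auto simp: is_stem_def hd_rev)
  have "takeWhile (\<lambda>x. x = 1) (rev S) = []" "dropWhile (\<lambda>x. x = 1) (rev S) = rev S"
    using S by (cases "rev S"; auto)+
  moreover have "takeWhile (\<lambda>x. x = 1) (rev T @ rev S) = rev T @ takeWhile (\<lambda>x. x = 1) (rev S)"
    "dropWhile (\<lambda>x. x = 1) (rev T @ rev S) = dropWhile (\<lambda>x. x = 1) (rev S)"
    by (rule takeWhile_append2 dropWhile_append2; use assms(2) in auto)+
  ultimately show "trailing_ones (S @ T) = T" "stem (S @ T) = S"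
    unfolding trailing_ones_def stem_def rev_append by simp_all
qed

lemma shift_stem_Nil: "shift_stem [] = []"
  by (simp add: shift_stem_def)

lemma phi_stem:
  assumes "is_stem S"
  shows "phi S = shift_stem S"
proof (cases S)
  case Nil
  then show ?thesis by (simp add: shift_stem_Nil)
next
  case (Cons x xs)
  then obtain n where n: "x = Suc n" "\<forall>x\<in>set xs. 0 < x"
    using assms by (cases x) (auto simp: is_stem_def)
  then have tw: "takeWhile (\<lambda>x. 0 < x) xs = xs" "dropWhile (\<lambda>x. 0 < x) xs = []"
    by (auto simp: takeWhile_eq_all_conv)
  have "trailing_ones S = []" "stem S = S"
    using trailing_ones_append[OF assms, of "[]"] by simp_all
  then show ?thesis
    unfolding Cons n(1) by (simp add: tw Let_def)
qed

text \<open>Three cases of the recursion merge here: the 0 is copied if \<open>S @ T\<close> is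
  empty, it is the head of the untouched rest if only \<open>T\<close> is empty, and otherwise it is
  the entry that \<open>tl\<close> drops and that reappears before \<open>T\<close>.\<close>

lemma phi_split:
  assumes "is_stem S" "\<forall>x\<in>set T. x = 1"
  shows "phi (S @ T @ 0 # R) = shift_stem S @ 0 # T @ phi R"
proof (cases "S @ T")
  case Nil
  then show ?thesis by (simp add: shift_stem_Nil)
next
  case (Cons x xs)
  have "\<forall>x\<in>set (S @ T). 0 < x" using assms by (auto simp: is_stem_def)
  with Cons obtain n where n: "x = Suc n" "\<forall>x\<in>set xs. 0 < x"
    by (cases x) auto
  then have tw: "takeWhile (\<lambda>x. 0 < x) (xs @ 0 # R) = xs" "dropWhile (\<lambda>x. 0 < x) (xs @ 0 # R) = 0 # R"
    by (auto simp: takeWhile_append dropWhile_append)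
  have "S @ T @ 0 # R = Suc n # xs @ 0 # R"
    using Cons n by (metis append_Cons append_assoc)
  moreover have "phi (Suc n # xs @ 0 # R) = shift_stem S @ 0 # T @ phi R"
    using trailing_ones_append[OF assms] unfolding Cons n(1) by (auto simp: tw Let_def)
  ultimately show ?thesis by metis
qed

lemma length_shift_stem [simp]: "length (shift_stem S) = length S"
  by (simp add: shift_stem_def)

lemma nth_shift_stem:
  assumes "i < length S"
  shows "shift_stem S ! i = (if length S < 2 then S ! i else if i = 0 then S ! 0 + 1
    else if i = length S - 1 then S ! i - 1 else S ! i)"
  using assms by (cases "S = []") (auto simp: shift_stem_def nth_list_update hd_conv_nth last_conv_nth)

lemma last_stem_ge_2: "is_stem S \<Longrightarrow> S \<noteq> [] \<Longrightarrow> 2 \<le> S ! (length S - 1)"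
  by (auto simp: is_stem_def last_conv_nth)

text \<open>Only the last entry can decrease, and the last entry of a stem is at least 2.\<close>

lemma nth_shift_stem_pos:
  assumes "is_stem S" "i < length S"
  shows "0 < shift_stem S ! i"
proof -
  have "0 < S ! i" using assms by (auto simp: is_stem_def)
  moreover have "2 \<le> S ! (length S - 1)" using assms last_stem_ge_2 by force
  ultimately show ?thesis
    using assms(2) by (auto simp: nth_shift_stem)
qed

lemma set_shift_stem_pos: "is_stem S \<Longrightarrow> x \<in> set (shift_stem S) \<Longrightarrow> 0 < x"
  by (auto simp: in_set_conv_nth nth_shift_stem_pos)

text \<open>In a stem of length one the head is also the last entry, hence at least 2 already; in a
  longer stem the positive head is raised. This keeps a shifted stem apart from a run of ones on its
  left.\<close>

lemma hd_shift_stem: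
  assumes "is_stem S" "S \<noteq> []"
  shows "2 \<le> hd (shift_stem S)"
proof -
  have "0 < S ! 0" using assms by (auto simp: is_stem_def)
  moreover have "2 \<le> S ! (length S - 1)" using assms by (rule last_stem_ge_2)
  moreover have "hd (shift_stem S) = shift_stem S ! 0"
    using assms by (metis hd_conv_nth length_0_conv length_shift_stem)
  moreover have "length S < 2 \<longleftrightarrow> length S = 1"
    using assms by (cases S) auto
  ultimately show ?thesis
    using assms by (auto simp: nth_shift_stem)
qed

lemma shift_stem_inject:
  assumes "is_stem S" "is_stem S'" "shift_stem S = shift_stem S'"
  shows "S = S'"
proof (rule nth_equalityI)
  show len: "length S = length S'"
    using assms(3) by (metis length_shift_stem)
  fix i assume i: "i < length S"
  have "shift_stem S ! i = shift_stem S' ! i" using assms by simp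
  moreover have "2 \<le> S ! (length S - 1)" "2 \<le> S' ! (length S - 1)"
    using assms last_stem_ge_2 i len by force+
  \<comment> \<open>Truncated subtraction cancels here: the two lower bounds above concern the last
    position, the only one that is decreased.\<close>
  moreover have "S ! i = S' ! i" if "S ! i - 1 = S' ! i - 1" "2 \<le> S ! i" "2 \<le> S' ! i"
    using that by linarith
  ultimately show "S ! i = S' ! i"
    using i len by (auto simp: nth_shift_stem split: if_splits)
qed

lemma length_phi: "phi_word xs \<Longrightarrow> length (phi xs) = length xs"
  by (induction rule: phi_word.induct) (simp_all add: phi_stem phi_split)

lemma sum_list_shift_stem:
  assumes "is_stem S"
  shows "sum_list (shift_stem S) = sum_list S"
proof (cases "2 \<le> length S")
  case True
  then obtain x zs where "S = x # zs" "zs \<noteq> []"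
    by (cases S; cases "tl S") auto
  then obtain ys y where S: "S = x # ys @ [y]"
    by (metis append_butlast_last_id)
  then have "shift_stem S = (x + 1) # ys @ [y - 1]"
    by (simp add: shift_stem_def list_update_append)
  moreover have "2 \<le> y" using assms S by (simp add: is_stem_def)
  ultimately show ?thesis using S by simp
qed (simp add: shift_stem_def)

lemma sum_list_phi: "phi_word xs \<Longrightarrow> sum_list (phi xs) = sum_list xs"
  by (induction rule: phi_word.induct) (simp_all add: phi_stem phi_split sum_list_shift_stem)

text \<open>The image starts with 0 if the first stem is empty, and otherwise with the head of a
  shifted stem, which is at least 2.\<close>

lemma hd_phi:
  assumes "phi_word xs" "xs \<noteq> []"
  shows "hd (phi xs) \<noteq> 1"
  using assms(1)
proof cases
  case stem
  then show ?thesis using assms(2) hd_shift_stem by (fastforce simp: phi_stem)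
next
  case (split S T R)
  then show ?thesis
    using hd_shift_stem[of S] length_shift_stem[of S] phi_split[of S T R]
    by (cases "S = []") (auto simp: shift_stem_Nil hd_append simp del: length_shift_stem)
qed

text \<open>A list has only one maximal prefix of entries satisfying \<open>P\<close>. The uses
  below take positivity and equality to 1 for \<open>P\<close>.\<close>

lemma append_eq_append_prefix_all:
  assumes "\<forall>x\<in>set a. P x" "\<forall>x\<in>set b. P x" "u = [] \<or> \<not> P (hd u)" "v = [] \<or> \<not> P (hd v)"
    and "a @ u = b @ v"
  shows "a = b \<and> u = v"
proof -
  have "takeWhile P u = []" "takeWhile P v = []"
    using assms(3,4) by (cases u; cases v; auto)+
  then have "takeWhile P (a @ u) = a" "takeWhile P (b @ v) = b"
    using assms(1,2) by (auto simp: takeWhile_append2)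
  with assms(5) show ?thesis by auto
qed

text \<open>The image is parsed from the left: its maximal positive prefix is the shifted stem, the
  run of ones after the separating 0 is \<open>T\<close>, and the rest is the image of
  \<open>R\<close>, to which the induction applies. An image without a 0 comes from a single
  stem.\<close>

lemma phi_inject:
  assumes "phi_word xs" "phi_word ys" "phi xs = phi ys"
  shows "xs = ys"
  using assms
proof (induction arbitrary: ys rule: phi_word.induct)
  case (stem S)
  from stem(2) show ?case
  proof cases
    case stem
    with \<open>is_stem S\<close> \<open>phi S = phi ys\<close> show ?thesis
      by (auto simp: phi_stem intro: shift_stem_inject)
  next
    case (split S' T R)
    with stem(1,3) have "0 \<in> set (shift_stem S)"
      by (simp add: phi_stem phi_split)
    then show ?thesis using stem(1) set_shift_stem_pos by blast
  qed
next
  case (split S T R)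
  from split(5) show ?case
  proof cases
    case stem
    with split have "0 \<in> set (shift_stem ys)"
      by (metis phi_split phi_stem in_set_conv_decomp)
    then show ?thesis using stem set_shift_stem_pos by blast
  next
    case s': (split S' T' R')
    have eq: "shift_stem S @ (0 # T @ phi R) = shift_stem S' @ (0 # T' @ phi R')"
      using split s' by (simp add: phi_split)
    have *: "shift_stem S = shift_stem S' \<and> 0 # T @ phi R = 0 # T' @ phi R'"
      by (rule append_eq_append_prefix_all[where P = "\<lambda>x. 0 < x", OF _ _ _ _ eq])
        (auto intro: set_shift_stem_pos[OF split(1)] set_shift_stem_pos[OF s'(2)])
    \<comment> \<open>No image starts with a one, so \<open>T\<close> is the whole run of ones after
      the 0.\<close>
    have "phi Q = [] \<or> hd (phi Q) \<noteq> 1" if "phi_word Q" for Q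
      using hd_phi[OF that] by fastforce
    then have "T = T' \<and> phi R = phi R'"
      using * split s' by (intro append_eq_append_prefix_all[where P = "\<lambda>x. x = 1"]) auto
    moreover have "S = S'" using * split(1) s'(2) shift_stem_inject by blast
    ultimately show ?thesis using split(4) s'(1,4) by simp
  qed
qed

text \<open>The bounds \<open>e\<^sub>i \<le> \<delta>\<^sub>i + 1\<close> and the closure conditions on filters are preserved
  because \<open>\<phi>\<close> increases an entry only at the start of a block, and an entry that it does not
  decrease is followed by a positive entry unless it forms a stem of length one.\<close>

definition stem_shifted :: "nat list \<Rightarrow> nat list \<Rightarrow> bool" where
  "stem_shifted xs ys \<longleftrightarrow> (\<forall>i<length xs. 2 \<le> ys ! i \<longrightarrow>
     (ys ! i \<le> xs ! i \<or> ys ! i = xs ! i + 1 \<and> (i = 0 \<or> xs ! (i - 1) = 0)) \<and>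
     (ys ! i < xs ! i \<or> ys ! i = xs ! i \<and> (i = 0 \<or> xs ! (i - 1) = 0) \<or>
       i + 1 < length xs \<and> 0 < ys ! (i + 1)))"

lemma stem_shiftedD:
  assumes "stem_shifted xs ys" "i < length xs" "2 \<le> ys ! i"
  shows "ys ! i \<le> xs ! i \<or> ys ! i = xs ! i + 1 \<and> (i = 0 \<or> xs ! (i - 1) = 0)"
    and "ys ! i < xs ! i \<or> ys ! i = xs ! i \<and> (i = 0 \<or> xs ! (i - 1) = 0) \<or>
       i + 1 < length xs \<and> 0 < ys ! (i + 1)"
  using assms(1)[unfolded stem_shifted_def, rule_format, OF assms(2,3)] by simp_all

text \<open>Only position 0 is raised. Every position but the last is followed by a positive entry;
  the last one is decreased, unless the stem has length one and is unchanged at position 0.\<close>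

lemma stem_shifted_shift_stem:
  assumes "is_stem S"
  shows "stem_shifted S (shift_stem S)"
  unfolding stem_shifted_def
proof (intro allI impI, goal_cases)
  case (1 i)
  have "2 \<le> S ! (length S - 1)" using assms last_stem_ge_2 1 by force
  moreover have "i + 1 < length S \<Longrightarrow> 0 < shift_stem S ! (i + 1)"
    using assms by (rule nth_shift_stem_pos)
  ultimately show ?case
    using 1 nth_shift_stem[OF 1(1)] by (auto split: if_splits)
qed

text \<open>Joining gives the first entry of the second word a predecessor, so \<open>i = 0\<close>
  in its conditions has to be replaced by \<open>last xs = 0\<close>. The last alternative covers
  image entries below 2, about which nothing is claimed.\<close>

lemma stem_shifted_append:
  assumes "stem_shifted xs ys" "stem_shifted zs ws" "length ys = length xs" "length ws = length zs"
    and "xs = [] \<or> last xs = 0 \<or> (\<forall>w\<in>set ws. w \<le> 1)"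
  shows "stem_shifted (xs @ zs) (ys @ ws)"
  unfolding stem_shifted_def
proof (intro allI impI, goal_cases)
  case (1 i)
  show ?case
  proof (cases "i < length xs")
    case True
    with 1 assms(3) have "2 \<le> ys ! i" by (simp add: nth_append)
    from stem_shiftedD[OF assms(1) True this] True assms(3)
    show ?thesis by (auto simp: nth_append)
  next
    case False
    define j where "j = i - length xs"
    have i: "i = length xs + j" "j < length zs" using False 1 by (auto simp: j_def)
    have w: "2 \<le> ws ! j" using 1 i assms(3) by (simp add: nth_append)
    then have "xs = [] \<or> last xs = 0"
      using assms(4,5) i nth_mem[of j ws] by (metis not_less_eq_eq One_nat_def Suc_1)
    then have prev: "j = 0 \<Longrightarrow> i = 0 \<or> (xs @ zs) ! (i - 1) = 0"
      using i by (cases "xs = []") (auto simp: nth_append last_conv_nth)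
    have "0 < j \<Longrightarrow> (xs @ zs) ! (i - 1) = zs ! (j - 1)"
      using i by (auto simp: nth_append)
    with stem_shiftedD[OF assms(2) i(2) w] show ?thesis
      using i assms(3) prev by (cases "j = 0") (auto simp: nth_append)
  qed
qed

lemma stem_shifted_small: "\<forall>y\<in>set ys. y \<le> 1 \<Longrightarrow> length ys = length xs \<Longrightarrow> stem_shifted xs ys"
  unfolding stem_shifted_def by (metis not_less_eq_eq One_nat_def Suc_1 nth_mem)

lemma stem_shifted_phi: "phi_word xs \<Longrightarrow> stem_shifted xs (phi xs)"
proof (induction rule: phi_word.induct)
  case (stem S)
  then show ?case by (simp add: phi_stem stem_shifted_shift_stem)
next
  case (split S T R)
  \<comment> \<open>The 0 stays grouped with \<open>T\<close> on both sides, so that lengths match.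
    The image of this middle part has entries at most 1, and the source prefix then ends in 0, as
    needed for joining \<open>R\<close>.\<close>
  have "stem_shifted (S @ (T @ [0])) (shift_stem S @ (0 # T))"
    using split stem_shifted_shift_stem[of S] stem_shifted_small[of "0 # T" "T @ [0]"]
    by (intro stem_shifted_append) auto
  then have "stem_shifted ((S @ (T @ [0])) @ R) ((shift_stem S @ (0 # T)) @ phi R)"
    by (rule stem_shifted_append) (use split in \<open>auto simp: length_phi\<close>)
  then show ?case using phi_split[OF split(1,2)] by simp
qed

section \<open>Applying \<open>phi\<close> factor by factor\<close>

definition phi_factors :: "(nat \<Rightarrow> bool) \<Rightarrow> (nat \<Rightarrow> nat) \<Rightarrow> nat \<Rightarrow> nat \<Rightarrow> nat list" where
  "phi_factors C d m n = concat (map phi (map (map d) (factors C [m..<n])))"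

text \<open>The defining recursion peels off one index; this form peels off the whole first factor,
  which stops before the first cut \<open>p\<close> after \<open>m\<close>, or at
  \<open>n\<close>.\<close>

lemma factors_upt:
  assumes "m < n"
  shows "\<exists>p. m < p \<and> p \<le> n \<and> (\<forall>j. m < j \<and> j < p \<longrightarrow> \<not> C j) \<and> (p < n \<longrightarrow> C p) \<and>
    factors C [m..<n] = [m..<p] # factors C [p..<n]"
  using assms
proof (induction "n - m" arbitrary: m rule: less_induct)
  case less
  show ?case
  proof (cases "Suc m = n")
    case True
    then show ?thesis by (intro exI[of _ n]) auto
  next
    case False
    with less have u: "Suc m < n" by simp
    then have l: "[m..<n] = m # Suc m # [Suc (Suc m)..<n]" "[Suc m..<n] = Suc m # [Suc (Suc m)..<n]"
      using less(2) by (simp_all add: upt_conv_Cons)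
    show ?thesis
    proof (cases "C (Suc m)")
      case True
      with u l show ?thesis by (intro exI[of _ "Suc m"]) auto
    next
      case C: False
      obtain p where p: "Suc m < p" "p \<le> n" "\<forall>j. Suc m < j \<and> j < p \<longrightarrow> \<not> C j" "p < n \<longrightarrow> C p"
        "factors C [Suc m..<n] = [Suc m..<p] # factors C [p..<n]"
        using less(1)[OF _ u] u by fastforce
      have "\<not> C j" if "m < j" "j < p" for j
        using that p(3) C by (cases "j = Suc m") auto
      moreover have "factors C [m..<n] = [m..<p] # factors C [p..<n]"
        using C p(1,5) unfolding l by (simp add: upt_conv_Cons del: upt_Suc)
      ultimately show ?thesis using p by (intro exI[of _ p]) (auto simp del: upt_Suc)
    qed
  qed
qed

text \<open>Induction on the number of remaining indices, one factor per step; \<open>C\<close> and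
  \<open>n\<close> stay fixed while the left end moves from \<open>n\<close> back to
  \<open>m\<close>.\<close>

lemma factors_induct:
  assumes "m \<le> n" and base: "P n"
    and step: "\<And>q p. q < p \<Longrightarrow> p \<le> n \<Longrightarrow> \<forall>j. q < j \<and> j < p \<longrightarrow> \<not> C j \<Longrightarrow> p < n \<longrightarrow> C p \<Longrightarrow>
      factors C [q..<n] = [q..<p] # factors C [p..<n] \<Longrightarrow> P p \<Longrightarrow> m \<le> q \<Longrightarrow> P q"
  shows "P m"
proof -
  have "P q" if "m \<le> q" "q \<le> n" for q
    using that
  proof (induction "n - q" arbitrary: q rule: less_induct)
    case less
    show ?case
    proof (cases "q = n")
      case False
      with less(3) obtain p where p: "q < p" "p \<le> n" "\<forall>j. q < j \<and> j < p \<longrightarrow> \<not> C j" "p < n \<longrightarrow> C p"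
          "factors C [q..<n] = [q..<p] # factors C [p..<n]"
        using factors_upt[of q n C] by auto
      moreover have "P p" using less(1)[of p] less(2) p by simp
      ultimately show ?thesis using step[of q p] less(2) by blast
    qed (use base in simp)
  qed
  with assms(1) show ?thesis by simp
qed

text \<open>Index \<open>i\<close> ends its factor exactly if there is a cut before
  \<open>i + 1\<close> or \<open>i + 1 = n\<close>, so this says, without mentioning factors, that
  none of them ends in a one.\<close>

definition cut_safe :: "(nat \<Rightarrow> bool) \<Rightarrow> (nat \<Rightarrow> nat) \<Rightarrow> nat \<Rightarrow> nat \<Rightarrow> bool" where
  "cut_safe C d m n \<longleftrightarrow> (\<forall>i\<in>{m..<n}. C (i + 1) \<or> i + 1 = n \<longrightarrow> d i \<noteq> 1)"

lemma cut_safe_last: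
  assumes "cut_safe C d m n" "q < p" "p \<le> n" "p < n \<longrightarrow> C p" "m \<le> q"
  shows "last (map d [q..<p]) \<noteq> 1"
proof -
  have "p - 1 \<in> {m..<n}" "p - 1 + 1 = p" using assms by auto
  then have "d (p - 1) \<noteq> 1" using assms unfolding cut_safe_def
    by (metis le_neq_implies_less)
  then show ?thesis using assms(2) by (simp add: last_map)
qed

lemmas phi_word_factor = phi_wordI[OF disjI2, OF cut_safe_last]

lemma phi_applicable_factors:
  assumes "m \<le> n" "cut_safe C d m n" "xs \<in> set (factors C [m..<n])"
  shows "phi_applicable (map d xs)"
  using assms(1,3)
proof (induction rule: factors_induct[where C = C, consumes 1])
  case 1
  then show ?case by simp
next
  case (2 q p)
  then show ?case
    using phi_applicableI[OF disjI2, OF cut_safe_last[OF assms(2), of q p]] by auto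
qed

lemma length_phi_factors:
  assumes "m \<le> n" "cut_safe C d m n"
  shows "length (phi_factors C d m n) = n - m"
  using assms(1)
proof (induction rule: factors_induct[where C = C, consumes 1])
  case (2 q p)
  then show ?case
    using length_phi[OF phi_word_factor[OF assms(2), of q p]] by (simp add: phi_factors_def)
qed (simp add: phi_factors_def)

lemma sum_list_phi_factors:
  assumes "m \<le> n" "cut_safe C d m n"
  shows "sum_list (phi_factors C d m n) = sum d {m..<n}"
  using assms(1)
proof (induction rule: factors_induct[where C = C, consumes 1])
  case (2 q p)
  then have "sum d {q..<n} = sum d {q..<p} + sum d {p..<n}"
    by (simp add: sum.atLeastLessThan_concat)
  then show ?case
    using 2 sum_list_phi[OF phi_word_factor[OF assms(2), of q p]]
    by (simp add: phi_factors_def interv_sum_list_conv_sum_set_nat)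
qed (simp add: phi_factors_def)

text \<open>With the same cut predicate both words have factors of equal lengths, and
  \<open>phi\<close> preserves lengths, so the concatenated images separate factor by
  factor.\<close>

lemma phi_factors_inject:
  assumes "m \<le> n" "cut_safe C d m n" "cut_safe C d' m n" "phi_factors C d m n = phi_factors C d' m n"
    "m \<le> i" "i < n"
  shows "d i = d' i"
  using assms(1,4-)
proof (induction rule: factors_induct[where C = C, consumes 1])
  case (2 q p)
  have w: "phi_word (map d [q..<p])" "phi_word (map d' [q..<p])"
    using 2 assms(2,3) phi_word_factor by blast+
  have "phi (map d [q..<p]) @ phi_factors C d p n = phi (map d' [q..<p]) @ phi_factors C d' p n"
    using 2 by (simp add: phi_factors_def)
  then have *: "phi (map d [q..<p]) = phi (map d' [q..<p])" "phi_factors C d p n = phi_factors C d' p n"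
    using w by (simp_all add: length_phi)
  then have "map d [q..<p] = map d' [q..<p]" using phi_inject w by blast
  with * 2 show ?case by (cases "i < p") auto
qed simp

text \<open>Carries \<open>hd_phi\<close> and \<open>stem_shifted_phi\<close> over from one factor
  to the concatenation, where \<open>first\<close> says that \<open>i\<close> opens a factor. In the
  third claim the positive successor lies in the same factor. These facts become the clauses of
  \<open>reduced_filter_code\<close>.\<close>

lemma nth_phi_factors:
  assumes "m \<le> n" "cut_safe C d m n" "m \<le> i" "i < n"
  defines "first \<equiv> i = m \<or> C i" and "y \<equiv> phi_factors C d m n ! (i - m)"
  shows "first \<Longrightarrow> y \<noteq> 1"
    and "2 \<le> y \<Longrightarrow> y \<le> d i \<or> y = d i + 1 \<and> (first \<or> d (i - 1) = 0)"
    and "2 \<le> y \<Longrightarrow> y < d i \<or> y = d i \<and> (first \<or> d (i - 1) = 0) \<or>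
       i + 1 < n \<and> \<not> C (i + 1) \<and> 0 < phi_factors C d m n ! (i + 1 - m)"
proof -
  \<comment> \<open>Written out in terms of \<open>m\<close>, because the induction varies the left
    end, on which \<open>first\<close> and \<open>y\<close> depend.\<close>
  have "((i = m \<or> C i) \<longrightarrow> phi_factors C d m n ! (i - m) \<noteq> 1) \<and>
    (2 \<le> phi_factors C d m n ! (i - m) \<longrightarrow>
      (phi_factors C d m n ! (i - m) \<le> d i \<or>
        phi_factors C d m n ! (i - m) = d i + 1 \<and> ((i = m \<or> C i) \<or> d (i - 1) = 0)) \<and>
      (phi_factors C d m n ! (i - m) < d i \<or>
        phi_factors C d m n ! (i - m) = d i \<and> ((i = m \<or> C i) \<or> d (i - 1) = 0) \<or>
       i + 1 < n \<and> \<not> C (i + 1) \<and> 0 < phi_factors C d m n ! (i + 1 - m)))"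
    using assms(1,3,4)
  proof (induction rule: factors_induct[where C = C, consumes 1])
    case (2 q p)
    define xs where "xs = map d [q..<p]"
    have w: "phi_word xs" using 2 assms(2) phi_word_factor xs_def by blast
    have l: "length xs = p - q" "length (phi xs) = p - q"
      using w by (simp_all add: xs_def length_phi)
    have eq: "phi_factors C d q n = phi xs @ phi_factors C d p n"
      using 2 by (simp add: phi_factors_def xs_def)
    show ?case
    proof (cases "i < p")
      case True
      have x: "xs ! (i - q) = d i" "i \<noteq> q \<Longrightarrow> xs ! (i - q - 1) = d (i - 1)"
        using True 2(8) by (simp_all add: xs_def)
      have y: "phi_factors C d q n ! (i - q) = phi xs ! (i - q)"
        "i + 1 < p \<Longrightarrow> phi_factors C d q n ! (i + 1 - q) = phi xs ! (i + 1 - q)"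
        using True 2(8) l by (auto simp: eq nth_append)
      have nC: "i = q \<or> \<not> C i" "i + 1 < p \<Longrightarrow> \<not> C (i + 1)" using 2(3,8) True by auto
      have "phi xs ! 0 \<noteq> 1"
        using hd_phi[OF w] l 2(1)
        by (metis hd_conv_nth length_0_conv zero_less_diff less_numeral_extra(3))
      then have hd: "i = q \<Longrightarrow> phi xs ! (i - q) \<noteq> 1" by simp
      have im: "i - q < length xs" "i - q + 1 < length xs \<longleftrightarrow> i + 1 < p" "i - q + 1 = i + 1 - q"
        "i - q = 0 \<longleftrightarrow> i = q"
        using True 2(8) l by auto
      note sh = stem_shiftedD[OF stem_shifted_phi[OF w] im(1), unfolded im x(1)]
      have sh1: "phi xs ! (i - q) \<le> d i \<or> phi xs ! (i - q) = d i + 1 \<and> (i = q \<or> d (i - 1) = 0)"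
        if "2 \<le> phi xs ! (i - q)"
        using sh(1)[OF that] x(2) by metis
      have sh2: "phi xs ! (i - q) < d i \<or> phi xs ! (i - q) = d i \<and> (i = q \<or> d (i - 1) = 0) \<or>
          i + 1 < p \<and> 0 < phi xs ! (i + 1 - q)"
        if "2 \<le> phi xs ! (i - q)"
        using sh(2)[OF that] x(2) im(2,3) by metis
      have "i + 1 < p \<Longrightarrow> i + 1 < n" using 2(2) by simp
      with hd sh1 sh2 y(2) nC show ?thesis
        unfolding y(1) by metis
    next
      case False
      have y: "phi_factors C d q n ! (i - q) = phi_factors C d p n ! (i - p)"
        "phi_factors C d q n ! (i + 1 - q) = phi_factors C d p n ! (i + 1 - p)"
        using False l 2(1) unfolding eq by (auto simp add: nth_append)
      \<comment> \<open>Removing the first factor does not change which later indices open a factor: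
        the new left end \<open>p < n\<close> is itself a cut.\<close>
      have first: "i = q \<or> C i \<longleftrightarrow> i = p \<or> C i"
        using False 2(1,4,9) by auto
      have "p \<le> i" using False by simp
      from 2(7)[OF this 2(9)] show ?thesis unfolding y first .
    qed
  qed simp
  note * = this[folded y_def first_def]
  show "first \<Longrightarrow> y \<noteq> 1"
    using * by blast
  show "2 \<le> y \<Longrightarrow> y \<le> d i \<or> y = d i + 1 \<and> (first \<or> d (i - 1) = 0)"
    using *[THEN conjunct2, THEN mp, THEN conjunct1] .
  show "2 \<le> y \<Longrightarrow> y < d i \<or> y = d i \<and> (first \<or> d (i - 1) = 0) \<or>
       i + 1 < n \<and> \<not> C (i + 1) \<and> 0 < phi_factors C d m n ! (i + 1 - m)"
    using *[THEN conjunct2, THEN mp, THEN conjunct2] .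
qed

section \<open>Codes\<close>

definition code_size :: "nat list \<Rightarrow> (nat \<Rightarrow> nat) \<Rightarrow> (nat \<Rightarrow> nat) \<Rightarrow> nat" where
  "code_size \<beta> a d = (\<Sum>j=1..ell \<beta> + 1. a j) + (\<Sum>i=1..ell \<beta>. d i)"

definition codes_agree :: "nat list \<Rightarrow> code \<Rightarrow> code \<Rightarrow> bool" where
  "codes_agree \<beta> c c' \<longleftrightarrow> (\<forall>j\<in>{1..ell \<beta> + 1}. fst c j = fst c' j) \<and>
     (\<forall>i\<in>{1..ell \<beta>}. snd c i = snd c' i)"

text \<open>The bottom of descending segment \<open>i\<close> lies below all of the next ascending
  one, whence \<open>0 < d i\<close>. A full descending segment contains the top of the preceding
  ascending one, so the ideal contains all of the latter, including the bottom that it shares with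
  descending segment \<open>i - 1\<close>.\<close>

definition ideal_code :: "nat list \<Rightarrow> (nat \<Rightarrow> nat) \<Rightarrow> (nat \<Rightarrow> nat) \<Rightarrow> bool" where
  "ideal_code \<beta> a d \<longleftrightarrow> (\<forall>j\<in>{1..ell \<beta> + 1}. a j \<le> alpha \<beta> j - 1) \<and>
     (\<forall>i\<in>{1..ell \<beta>}. d i \<le> card (desc \<beta> i) \<and> (0 < a (i + 1) \<longrightarrow> 0 < d i) \<and>
       (d i = card (desc \<beta> i) \<longrightarrow> a i = alpha \<beta> i - 1 \<and> (2 \<le> i \<longrightarrow> 0 < d (i - 1))))"

text \<open>The dual conditions: ascending segment \<open>i\<close> lies below the top of descending
  segment \<open>i\<close>, and a full descending segment contains the bottom of ascending segment
  \<open>i + 1\<close>, which forces everything above it.\<close>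

definition filter_code :: "nat list \<Rightarrow> (nat \<Rightarrow> nat) \<Rightarrow> (nat \<Rightarrow> nat) \<Rightarrow> bool" where
  "filter_code \<beta> b e \<longleftrightarrow> (\<forall>j\<in>{1..ell \<beta> + 1}. b j \<le> alpha \<beta> j - 1) \<and>
     (\<forall>i\<in>{1..ell \<beta>}. e i \<le> card (desc \<beta> i) \<and> (0 < b i \<longrightarrow> 0 < e i) \<and>
       (e i = card (desc \<beta> i) \<longrightarrow> b (i + 1) = alpha \<beta> (i + 1) - 1 \<and> (i < ell \<beta> \<longrightarrow> 0 < e (i + 1))))"

text \<open>The codes that occur before and after (PH2), for ideals of size at most
  \<open>min \<beta>\<^sub>1 \<beta>\<^sub>s\<close>.\<close>

definition reduced_ideal_code :: "nat list \<Rightarrow> (nat \<Rightarrow> nat) \<Rightarrow> (nat \<Rightarrow> nat) \<Rightarrow> bool" where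
  "reduced_ideal_code \<beta> a d \<longleftrightarrow> (\<forall>j\<in>{1..ell \<beta> + 1}. a j \<le> alpha \<beta> j - 1) \<and>
     (\<forall>i\<in>{1..ell \<beta>}. d i \<le> card (desc \<beta> i) \<and>
       (d i = 1 \<longrightarrow> i < ell \<beta> \<and> a (i + 1) = alpha \<beta> (i + 1) - 1) \<and>
       (d i = card (desc \<beta> i) \<longrightarrow> 2 \<le> i \<and> a i = alpha \<beta> i - 1 \<and> 0 < d (i - 1)))"

definition reduced_filter_code :: "nat list \<Rightarrow> (nat \<Rightarrow> nat) \<Rightarrow> (nat \<Rightarrow> nat) \<Rightarrow> bool" where
  "reduced_filter_code \<beta> b e \<longleftrightarrow> (\<forall>j\<in>{1..ell \<beta> + 1}. b j \<le> alpha \<beta> j - 1) \<and>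
     (\<forall>i\<in>{1..ell \<beta>}. e i \<le> card (desc \<beta> i) \<and>
       (e i = 1 \<longrightarrow> b i = alpha \<beta> i - 1) \<and>
       (e i = card (desc \<beta> i) \<longrightarrow>
         i < ell \<beta> \<and> b (i + 1) = alpha \<beta> (i + 1) - 1 \<and> 0 < e (i + 1)))"

section \<open>Sizes of codes and step (PH1)\<close>

lemma code_size_ge:
  assumes "i \<in> {1..ell \<beta>}" "j \<in> {1..ell \<beta> + 1}"
  shows "a j + d i \<le> code_size \<beta> a d"
  unfolding code_size_def using assms by (intro add_mono member_le_sum) auto

text \<open>Pairs index \<open>i + 1\<close> with \<open>i\<close>, since (PH1) moves an element
  from \<open>d i\<close> to \<open>a (i + 1)\<close>; \<open>a 1\<close> never changes.\<close>

lemma sum_first_shift: "(\<Sum>j=1..n + 1. f j) = f 1 + (\<Sum>i=1..n. f (i + 1))" for f :: "nat \<Rightarrow> nat"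
  by (induction n) auto

lemma code_size_PH1:
  "code_size \<beta> (fst (PH1 \<beta> (a, d))) (snd (PH1 \<beta> (a, d))) = code_size \<beta> a d"
proof -
  define a' d' where "a' = fst (PH1 \<beta> (a, d))" and "d' = snd (PH1 \<beta> (a, d))"
  have "a' 1 = a 1" by (simp add: a'_def PH1_def)
  moreover have "(\<Sum>i=1..ell \<beta>. a' (i + 1) + d' i) = (\<Sum>i=1..ell \<beta>. a (i + 1) + d i)"
    by (rule sum.cong) (auto simp: a'_def d'_def PH1_def)
  ultimately show ?thesis
    unfolding code_size_def sum_first_shift a'_def[symmetric] d'_def[symmetric]
    by (simp add: sum.distrib)
qed

lemma code_size_PH3:
  "code_size \<beta> (fst (PH3 \<beta> (b, e))) (snd (PH3 \<beta> (b, e))) = code_size \<beta> b e"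
proof -
  define b' e' where "b' = fst (PH3 \<beta> (b, e))" and "e' = snd (PH3 \<beta> (b, e))"
  have "b' (ell \<beta> + 1) = b (ell \<beta> + 1)" by (simp add: b'_def PH3_def)
  moreover have "(\<Sum>i=1..ell \<beta>. b' i + e' i) = (\<Sum>i=1..ell \<beta>. b i + e i)"
    by (rule sum.cong) (auto simp: b'_def e'_def PH3_def)
  ultimately show ?thesis
    unfolding code_size_def b'_def[symmetric] e'_def[symmetric]
    by (simp add: sum.distrib)
qed

text \<open>A one left by (PH1) sits before a full ascending segment; at the last index these
  elements would exceed the size bound. The same happens if the first descending segment is full,
  since then the first ascending one is full too.\<close>

lemma reduced_ideal_code_PH1:
  assumes ic: "ideal_code \<beta> a d"
    and two: "\<forall>i\<in>{1..ell \<beta>}. 2 \<le> card (desc \<beta> i)"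
    and size: "0 < ell \<beta> \<Longrightarrow> code_size \<beta> a d \<le> alpha \<beta> 1 - 1"
      "0 < ell \<beta> \<Longrightarrow> code_size \<beta> a d \<le> alpha \<beta> (ell \<beta> + 1) - 1"
    and PH1: "PH1 \<beta> (a, d) = (a', d')"
  shows "reduced_ideal_code \<beta> a' d'"
proof -
  have a': "a' j = (if 2 \<le> j \<and> j - 1 \<le> ell \<beta> \<and> d (j - 1) = 1 \<and> a j < alpha \<beta> j - 1 then a j + 1 else a j)" for j
    using PH1 by (auto simp: PH1_def)
  have d': "d' i = (if i \<in> {1..ell \<beta>} \<and> d i = 1 \<and> a (i + 1) < alpha \<beta> (i + 1) - 1 then 0 else d i)" for i
    using PH1 by (auto simp: PH1_def)
  have a_le: "a j \<le> alpha \<beta> j - 1" if "j \<in> {1..ell \<beta> + 1}" for j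
    using ic that unfolding ideal_code_def by blast
  have "a' j \<le> alpha \<beta> j - 1" if "j \<in> {1..ell \<beta> + 1}" for j
    using a_le[OF that] by (simp add: a')
  moreover have "d' i \<le> card (desc \<beta> i) \<and>
       (d' i = 1 \<longrightarrow> i < ell \<beta> \<and> a' (i + 1) = alpha \<beta> (i + 1) - 1) \<and>
       (d' i = card (desc \<beta> i) \<longrightarrow> 2 \<le> i \<and> a' i = alpha \<beta> i - 1 \<and> 0 < d' (i - 1))"
    if i: "i \<in> {1..ell \<beta>}" for i
  proof (intro conjI impI)
    have di: "d i \<le> card (desc \<beta> i)"
      using ic i unfolding ideal_code_def by blast
    show "d' i \<le> card (desc \<beta> i)" using di by (simp add: d')
    assume 1: "d' i = 1"
    then have d1: "d i = 1" "\<not> a (i + 1) < alpha \<beta> (i + 1) - 1"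
      using i by (auto simp: d' split: if_splits)
    show "a' (i + 1) = alpha \<beta> (i + 1) - 1"
      using d1 a_le[of "i + 1"] i by (simp add: a')
    show "i < ell \<beta>"
    proof (rule ccontr)
      assume "\<not> i < ell \<beta>"
      then have "i = ell \<beta>" using i by simp
      then show False
        using code_size_ge[OF i, of "i + 1" a d] size(2) d1 i by simp
    qed
  next
    have di: "d i = card (desc \<beta> i) \<Longrightarrow> a i = alpha \<beta> i - 1 \<and> (2 \<le> i \<longrightarrow> 0 < d (i - 1))"
      using ic i unfolding ideal_code_def by blast
    have two_i: "2 \<le> card (desc \<beta> i)" using two i by blast
    assume "d' i = card (desc \<beta> i)"
    then have full: "d i = card (desc \<beta> i)" using two_i by (auto simp: d' split: if_splits)
    with di have ai: "a i = alpha \<beta> i - 1" "2 \<le> i \<Longrightarrow> 0 < d (i - 1)" by auto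
    show "2 \<le> i"
    proof (rule ccontr)
      assume "\<not> 2 \<le> i"
      then have "i = 1" using i by simp
      then show False
        using code_size_ge[OF i, of 1 a d] size(1) full two_i ai i by simp
    qed
    \<comment> \<open>As \<open>a i\<close> is maximal, (PH1) did not act on index
      \<open>i - 1\<close>.\<close>
    then show "a' i = alpha \<beta> i - 1" "0 < d' (i - 1)"
      using ai by (auto simp: a' d')
  qed
  ultimately show ?thesis unfolding reduced_ideal_code_def by blast
qed

lemma PH1_inject:
  assumes "ideal_code \<beta> a d" "ideal_code \<beta> a' d'"
    and eq: "codes_agree \<beta> (PH1 \<beta> (a, d)) (PH1 \<beta> (a', d'))"
  shows "codes_agree \<beta> (a, d) (a', d')"
proof -
  have *: "a (i + 1) = a' (i + 1) \<and> d i = d' i" if i: "i \<in> {1..ell \<beta>}" for i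
  proof -
    have "fst (PH1 \<beta> (a, d)) (i + 1) = fst (PH1 \<beta> (a', d')) (i + 1)"
      "snd (PH1 \<beta> (a, d)) i = snd (PH1 \<beta> (a', d')) i"
      using eq i unfolding codes_agree_def by auto
    moreover have "0 < a (i + 1) \<longrightarrow> 0 < d i" "0 < a' (i + 1) \<longrightarrow> 0 < d' i"
      using assms(1,2) i unfolding ideal_code_def by blast+
    ultimately show ?thesis
      using i by (auto simp: PH1_def split: if_splits)
  qed
  have "fst (PH1 \<beta> (a, d)) 1 = fst (PH1 \<beta> (a', d')) 1"
    using eq unfolding codes_agree_def by auto
  then have "a 1 = a' 1" by (simp add: PH1_def)
  moreover have "a j = a' j" if "j \<in> {1..ell \<beta> + 1}" "j \<noteq> 1" for j
    using *[of "j - 1"] that by force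
  ultimately show ?thesis
    using * unfolding codes_agree_def fst_conv snd_conv by metis
qed

section \<open>Step (PH2)\<close>

lemma PH2_eq:
  "PH2 \<beta> (a, d) = (a, \<lambda>i. phi_factors (\<lambda>i. a i < alpha \<beta> i - 1) d 1 (ell \<beta> + 1) ! (i - 1))"
  by (simp add: PH2_def PH2_factors_def phi_factors_def)

text \<open>A one occurs only at \<open>i < ell \<beta>\<close> with ascending segment
  \<open>i + 1\<close> full, where no cut is made.\<close>

lemma cut_safe_reduced:
  assumes "reduced_ideal_code \<beta> a d"
  shows "cut_safe (\<lambda>i. a i < alpha \<beta> i - 1) d 1 (ell \<beta> + 1)"
  using assms unfolding cut_safe_def reduced_ideal_code_def by fastforce

lemma code_size_PH2:
  assumes "reduced_ideal_code \<beta> a d" "PH2 \<beta> (a, d) = (b, e)"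
  shows "code_size \<beta> b e = code_size \<beta> a d"
proof -
  let ?y = "phi_factors (\<lambda>i. a i < alpha \<beta> i - 1) d 1 (ell \<beta> + 1)"
  have len: "length ?y = ell \<beta>"
    using length_phi_factors[OF _ cut_safe_reduced[OF assms(1)]] by simp
  have "(\<Sum>i=1..ell \<beta>. ?y ! (i - 1)) = (\<Sum>i<ell \<beta>. ?y ! i)"
    by (rule sum.reindex_bij_witness[of _ Suc "\<lambda>i. i - 1"]) auto
  also have "\<dots> = sum_list ?y"
    unfolding sum_list_sum_nth len atLeast0LessThan ..
  also have "\<dots> = (\<Sum>i=1..ell \<beta>. d i)"
    using sum_list_phi_factors[OF _ cut_safe_reduced[OF assms(1)]]
    by (simp add: atLeastLessThanSuc_atLeastAtMost)
  finally show ?thesis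
    using assms(2) by (auto simp: PH2_eq code_size_def)
qed

text \<open>The clauses come from \<open>nth_phi_factors\<close>. An entry is raised only where a
  factor opens or a 0 precedes, and there \<open>d i\<close> is not full. An entry 1 does not open a
  factor, so there is no cut before it. A full image entry is followed by a positive one with no cut
  between them.\<close>

lemma reduced_filter_code_PH2:
  assumes rc: "reduced_ideal_code \<beta> a d"
    and two: "\<forall>i\<in>{1..ell \<beta>}. 2 \<le> card (desc \<beta> i)"
    and PH2: "PH2 \<beta> (a, d) = (b, e)"
  shows "reduced_filter_code \<beta> b e"
proof -
  let ?C = "\<lambda>i. a i < alpha \<beta> i - 1"
  have b: "b = a" and e: "e i = phi_factors ?C d 1 (ell \<beta> + 1) ! (i - 1)" for i
    using PH2 by (auto simp: PH2_eq)
  have a_le: "a j \<le> alpha \<beta> j - 1" if "j \<in> {1..ell \<beta> + 1}" for j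
    using rc that unfolding reduced_ideal_code_def by blast
  have "e i \<le> card (desc \<beta> i) \<and> (e i = 1 \<longrightarrow> b i = alpha \<beta> i - 1) \<and>
       (e i = card (desc \<beta> i) \<longrightarrow>
         i < ell \<beta> \<and> b (i + 1) = alpha \<beta> (i + 1) - 1 \<and> 0 < e (i + 1))"
    if i: "i \<in> {1..ell \<beta>}" for i
  proof -
    have im: "1 \<le> ell \<beta> + 1" "1 \<le> i" "i < ell \<beta> + 1" using i by auto
    have e1: "e (i + 1) = phi_factors ?C d 1 (ell \<beta> + 1) ! (i + 1 - 1)" by (rule e)
    note nth = nth_phi_factors[OF im(1) cut_safe_reduced[OF rc] im(2,3), folded e e1]
    have two_i: "2 \<le> card (desc \<beta> i)" using two i by blast
    have d: "d i \<le> card (desc \<beta> i)"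
      "d i = card (desc \<beta> i) \<Longrightarrow> \<not> ((i = 1 \<or> ?C i) \<or> d (i - 1) = 0)"
      using rc i unfolding reduced_ideal_code_def by auto
    have "e i \<le> card (desc \<beta> i)"
    proof (cases "2 \<le> e i")
      case True
      with nth(2) d show ?thesis by fastforce
    qed (use two_i in linarith)
    moreover have "b i = alpha \<beta> i - 1" if "e i = 1"
      using nth(1) that a_le[of i] i b by fastforce
    moreover have "i < ell \<beta> \<and> b (i + 1) = alpha \<beta> (i + 1) - 1 \<and> 0 < e (i + 1)"
      if "e i = card (desc \<beta> i)"
    proof -
      have "i + 1 < ell \<beta> + 1 \<and> \<not> ?C (i + 1) \<and> 0 < e (i + 1)"
        using nth(3) two_i that d by fastforce
      then show ?thesis using a_le[of "i + 1"] b by auto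
    qed
    ultimately show ?thesis by blast
  qed
  with a_le b show ?thesis unfolding reduced_filter_code_def by blast
qed

text \<open>(PH2) keeps \<open>a\<close>, so agreement of the results gives the same cuts on both
  sides, and \<open>phi_factors_inject\<close> applies.\<close>

lemma PH2_inject:
  assumes rc: "reduced_ideal_code \<beta> a d" "reduced_ideal_code \<beta> a' d'"
    and eq: "codes_agree \<beta> (PH2 \<beta> (a, d)) (PH2 \<beta> (a', d'))"
  shows "codes_agree \<beta> (a, d) (a', d')"
proof -
  let ?C = "\<lambda>a i. a i < alpha \<beta> i - 1" and ?n = "ell \<beta> + 1"
  have a: "a j = a' j" if "j \<in> {1..ell \<beta> + 1}" for j
    using eq that unfolding codes_agree_def PH2_eq by auto
  have cs: "cut_safe (?C a) d 1 ?n" "cut_safe (?C a') d' 1 ?n"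
    using rc cut_safe_reduced by blast+
  have cs': "cut_safe (?C a) d' 1 ?n"
    using cs(2) a unfolding cut_safe_def by auto
  have "factors C is = factors C' is" if "\<forall>i\<in>set is. C i = C' i" for C C' "is"
    using that by (induction C "is" rule: factors.induct) auto
  then have "factors (?C a) [1..<?n] = factors (?C a') [1..<?n]"
    using a by fastforce
  then have ph: "phi_factors (?C a) d' 1 ?n = phi_factors (?C a') d' 1 ?n"
    by (simp add: phi_factors_def)
  have "phi_factors (?C a) d 1 ?n = phi_factors (?C a') d' 1 ?n"
  proof (rule nth_equalityI)
    show "length (phi_factors (?C a) d 1 ?n) = length (phi_factors (?C a') d' 1 ?n)"
      using cs by (simp add: length_phi_factors)
    fix i assume "i < length (phi_factors (?C a) d 1 ?n)"
    then have "i < ell \<beta>" using cs by (simp add: length_phi_factors)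
    then have "i + 1 \<in> {1..ell \<beta>}" by simp
    then have "snd (PH2 \<beta> (a, d)) (i + 1) = snd (PH2 \<beta> (a', d')) (i + 1)"
      using eq unfolding codes_agree_def by blast
    then show "phi_factors (?C a) d 1 ?n ! i = phi_factors (?C a') d' 1 ?n ! i"
      by (simp add: PH2_eq)
  qed
  then have "d i = d' i" if "i \<in> {1..ell \<beta>}" for i
    using phi_factors_inject[OF _ cs(1) cs'] ph that by simp
  with a show ?thesis unfolding codes_agree_def by simp
qed

section \<open>Step (PH3)\<close>

lemma filter_code_PH3:
  assumes rc: "reduced_filter_code \<beta> b e"
    and two: "\<forall>i\<in>{1..ell \<beta>}. 2 \<le> card (desc \<beta> i)"
    and PH3: "PH3 \<beta> (b, e) = (b', e')"
  shows "filter_code \<beta> b' e'"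
proof -
  have b': "b' j = (if j \<in> {1..ell \<beta>} \<and> e j = 0 \<and> 0 < b j then b j - 1 else b j)" for j
    using PH3 by (auto simp: PH3_def)
  have e': "e' i = (if i \<in> {1..ell \<beta>} \<and> e i = 0 \<and> 0 < b i then 1 else e i)" for i
    using PH3 by (auto simp: PH3_def)
  have "b' j \<le> alpha \<beta> j - 1" if "j \<in> {1..ell \<beta> + 1}" for j
    using rc that unfolding reduced_filter_code_def b' by force
  moreover have "e' i \<le> card (desc \<beta> i) \<and> (0 < b' i \<longrightarrow> 0 < e' i) \<and>
       (e' i = card (desc \<beta> i) \<longrightarrow> b' (i + 1) = alpha \<beta> (i + 1) - 1 \<and> (i < ell \<beta> \<longrightarrow> 0 < e' (i + 1)))"
    if i: "i \<in> {1..ell \<beta>}" for i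
  proof -
    have two_i: "2 \<le> card (desc \<beta> i)" using two i by blast
    have e: "e i \<le> card (desc \<beta> i)" "e i = card (desc \<beta> i) \<Longrightarrow>
        i < ell \<beta> \<and> b (i + 1) = alpha \<beta> (i + 1) - 1 \<and> 0 < e (i + 1)"
      using rc i unfolding reduced_filter_code_def by blast+
    have "e' i \<le> card (desc \<beta> i)" using e(1) two_i by (auto simp: e')
    moreover have "0 < b' i \<longrightarrow> 0 < e' i" using i by (auto simp: b' e')
    \<comment> \<open>A full entry is at least 2, so it was not produced by (PH3), and
      \<open>0 < e (i + 1)\<close> keeps (PH3) from lowering \<open>b (i + 1)\<close>.\<close>
    moreover have "b' (i + 1) = alpha \<beta> (i + 1) - 1 \<and> 0 < e' (i + 1)" if "e' i = card (desc \<beta> i)"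
    proof -
      have "e i = card (desc \<beta> i)" using that two_i by (auto simp: e' split: if_splits)
      with e(2) show ?thesis by (simp add: b' e')
    qed
    ultimately show ?thesis by blast
  qed
  ultimately show ?thesis unfolding filter_code_def by blast
qed

text \<open>A move leaves second entry 1 and first entry below \<open>A\<close>, whereas an unmoved
  pair with second entry 1 has first entry \<open>A\<close>. In the application \<open>A\<close> is
  \<open>alpha \<beta> i - 1\<close>.\<close>

lemma borrow_inject:
  fixes x y x' y' A :: nat
  assumes "(if y = 0 \<and> 0 < x then x - 1 else x) = (if y' = 0 \<and> 0 < x' then x' - 1 else x')"
    "(if y = 0 \<and> 0 < x then 1 else y) = (if y' = 0 \<and> 0 < x' then 1 else y')"
    "y = 1 \<longrightarrow> x = A" "y' = 1 \<longrightarrow> x' = A" "x \<le> A" "x' \<le> A"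
  shows "x = x' \<and> y = y'"
  using assms by presburger

lemma PH3_inject:
  assumes "reduced_filter_code \<beta> b e" "reduced_filter_code \<beta> b' e'"
    and eq: "codes_agree \<beta> (PH3 \<beta> (b, e)) (PH3 \<beta> (b', e'))"
  shows "codes_agree \<beta> (b, e) (b', e')"
proof -
  have *: "b i = b' i \<and> e i = e' i" if i: "i \<in> {1..ell \<beta>}" for i
  proof -
    have "fst (PH3 \<beta> (b, e)) i = fst (PH3 \<beta> (b', e')) i"
      "snd (PH3 \<beta> (b, e)) i = snd (PH3 \<beta> (b', e')) i"
      using eq i unfolding codes_agree_def by auto
    then have "(if e i = 0 \<and> 0 < b i then b i - 1 else b i) = (if e' i = 0 \<and> 0 < b' i then b' i - 1 else b' i)"
      "(if e i = 0 \<and> 0 < b i then 1 else e i) = (if e' i = 0 \<and> 0 < b' i then 1 else e' i)"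
      using i by (simp_all add: PH3_def Let_def)
    moreover have "e i = 1 \<longrightarrow> b i = alpha \<beta> i - 1" "e' i = 1 \<longrightarrow> b' i = alpha \<beta> i - 1"
      using assms(1,2) i unfolding reduced_filter_code_def by blast+
    moreover have "b i \<le> alpha \<beta> i - 1" "b' i \<le> alpha \<beta> i - 1"
      using assms(1,2) i unfolding reduced_filter_code_def by auto
    ultimately show ?thesis
      by (rule borrow_inject)
  qed
  have "fst (PH3 \<beta> (b, e)) (ell \<beta> + 1) = fst (PH3 \<beta> (b', e')) (ell \<beta> + 1)"
    using eq unfolding codes_agree_def by auto
  then have "b (ell \<beta> + 1) = b' (ell \<beta> + 1)" by (simp add: PH3_def)
  moreover have "b j = b' j" if "j \<in> {1..ell \<beta> + 1}" "j \<noteq> ell \<beta> + 1" for j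
    using *[of j] that by simp
  ultimately show ?thesis
    using * unfolding codes_agree_def fst_conv snd_conv by metis
qed

section \<open>Ideals and filters of a fence\<close>

abbreviation pt :: "nat list \<Rightarrow> nat \<Rightarrow> nat" where
  "pt \<beta> i \<equiv> sum_list (take i \<beta>)"

section \<open>Chains and finite sets\<close>

lemma seg_total:
  assumes "s \<in> {1..length \<beta>}" "x \<in> seg \<beta> s" "y \<in> seg \<beta> s"
  shows "(x, y) \<in> fence_order \<beta> \<or> (y, x) \<in> fence_order \<beta>"
proof -
  have "(if odd s then x \<le> y else y \<le> x) \<or> (if odd s then y \<le> x else x \<le> y)" by auto
  with assms show ?thesis unfolding fence_order_def by blast
qed

lemma finite_seg [simp]: "finite (seg \<beta> s)"
  by (simp add: seg_def)

lemma finite_unshared_asc [simp]: "finite (unshared_asc \<beta> j)"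
  by (simp add: unshared_asc_def)

lemma finite_desc [simp]: "finite (desc \<beta> i)"
  by (simp add: desc_def)

lemma finite_fence [simp]: "finite (fence \<beta>)"
  by (simp add: fence_def)

lemma lower_idealD: "lower_ideal \<beta> I \<Longrightarrow> (x, y) \<in> fence_order \<beta> \<Longrightarrow> y \<in> I \<Longrightarrow> x \<in> I"
  unfolding lower_ideal_def by blast

lemma upper_idealD: "upper_ideal \<beta> U \<Longrightarrow> (x, y) \<in> fence_order \<beta> \<Longrightarrow> x \<in> U \<Longrightarrow> y \<in> U"
  unfolding upper_ideal_def by blast

text \<open>Repeatedly add the least missing element. On descending segments positions run against
  the order, so initial subsets there are upward closed.\<close>

lemma ex_initial_subset:
  fixes C :: "nat set"
  assumes "finite C" "m \<le> card C"
  shows "\<exists>X\<subseteq>C. card X = m \<and> (\<forall>x\<in>X. \<forall>y\<in>C. y \<le> x \<longrightarrow> y \<in> X)"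
  using assms(2)
proof (induction m)
  case 0
  then show ?case by (intro exI[of _ "{}"]) auto
next
  case (Suc m)
  then obtain X where X: "X \<subseteq> C" "card X = m" "\<forall>x\<in>X. \<forall>y\<in>C. y \<le> x \<longrightarrow> y \<in> X" by auto
  have fin: "finite X" using X(1) assms(1) by (rule finite_subset)
  have "C - X \<noteq> {}" using Suc.prems X by (metis Diff_eq_empty_iff Suc_n_not_le_n subset_antisym)
  then have min: "Min (C - X) \<in> C - X" "\<And>y. y \<in> C - X \<Longrightarrow> Min (C - X) \<le> y"
    using assms(1) Min_in[of "C - X"] Min_le[of "C - X"] by auto
  show ?case
  proof (intro exI conjI)
    show "insert (Min (C - X)) X \<subseteq> C" using X min by auto
    show "card (insert (Min (C - X)) X) = Suc m" using fin X min by simp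
    show "\<forall>x\<in>insert (Min (C - X)) X. \<forall>y\<in>C. y \<le> x \<longrightarrow> y \<in> insert (Min (C - X)) X"
      using X(3) min(2) by (metis DiffI insert_iff le_antisym)
  qed
qed

text \<open>Take the complement of an initial subset.\<close>

lemma ex_final_subset:
  fixes C :: "nat set"
  assumes "finite C" "m \<le> card C"
  shows "\<exists>X\<subseteq>C. card X = m \<and> (\<forall>x\<in>X. \<forall>y\<in>C. x \<le> y \<longrightarrow> y \<in> X)"
proof -
  obtain Y where Y: "Y \<subseteq> C" "card Y = card C - m" "\<forall>x\<in>Y. \<forall>y\<in>C. y \<le> x \<longrightarrow> y \<in> Y"
    using ex_initial_subset[OF assms(1), of "card C - m"] by auto
  have "card (C - Y) = m"
    using Y(1,2) assms finite_subset[OF Y(1) assms(1)] by (simp add: card_Diff_subset)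
  then show ?thesis
    using Y by (intro exI[of _ "C - Y"]) auto
qed

section \<open>Segments, shared elements and the partition of the fence\<close>

locale odd_composition =
  fixes \<beta> :: "nat list" and l :: nat
  assumes pos: "\<forall>x\<in>set \<beta>. 0 < x" and len: "length \<beta> = 2 * l + 1"
begin

lemma ell [simp]: "ell \<beta> = l"
  by (simp add: ell_def len)

lemma pt_less: "i < j \<Longrightarrow> j \<le> 2 * l + 1 \<Longrightarrow> pt \<beta> i < pt \<beta> j"
  using sum_list_take_less[OF pos] len by simp

lemma pt_mem_seg:
  shows "1 \<le> i \<Longrightarrow> i \<le> 2 * l + 1 \<Longrightarrow> pt \<beta> i \<in> seg \<beta> i"
    and "i \<le> 2 * l \<Longrightarrow> pt \<beta> i \<in> seg \<beta> (Suc i)"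
proof -
  show "pt \<beta> i \<in> seg \<beta> i" if "1 \<le> i" "i \<le> 2 * l + 1"
    using pt_less[of "i - 1" i] that unfolding seg_def by (simp add: less_imp_le)
  show "pt \<beta> i \<in> seg \<beta> (Suc i)" if "i \<le> 2 * l"
    using pt_less[of i "Suc i"] that unfolding seg_def by (simp add: less_imp_le)
qed

lemma shared_iff: "shared \<beta> x \<longleftrightarrow> (\<exists>i\<in>{1..2 * l}. x = pt \<beta> i)"
proof
  assume "shared \<beta> x"
  then obtain i j where ij: "i \<in> {1..2 * l + 1}" "j \<in> {1..2 * l + 1}" "i < j" "x \<in> seg \<beta> i" "x \<in> seg \<beta> j"
    unfolding shared_def len by (metis linorder_neqE_nat)
  then have "x = pt \<beta> i" using seg_inter(2)[OF pos _ ij(3) _ ij(4,5)] len by auto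
  moreover have "i \<in> {1..2 * l}" using ij by auto
  ultimately show "\<exists>i\<in>{1..2 * l}. x = pt \<beta> i" by blast
next
  assume "\<exists>i\<in>{1..2 * l}. x = pt \<beta> i"
  then obtain i where "i \<in> {1..2 * l}" "x = pt \<beta> i" by blast
  then show "shared \<beta> x"
    unfolding shared_def len
    by (intro bexI[of _ i] bexI[of _ "Suc i"]) (auto intro: pt_mem_seg)
qed

text \<open>Strict growth of \<open>pt\<close> leaves only the two ends of the segment. The side
  conditions reflect that the left end of the first and the right end of the last segment are not
  glued.\<close>

lemma shared_asc_cases:
  assumes "j \<in> {1..l + 1}" "x \<in> seg \<beta> (2 * j - 1)" "shared \<beta> x"
  obtains "2 \<le> j" "x = pt \<beta> (2 * j - 2)" | "j \<le> l" "x = pt \<beta> (2 * j - 1)"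
proof -
  from assms(3) obtain i where i: "i \<in> {1..2 * l}" "x = pt \<beta> i" by (auto simp: shared_iff)
  have x: "pt \<beta> (2 * j - 2) \<le> x" "x \<le> pt \<beta> (2 * j - 1)"
    using assms(2) by (auto simp: seg_def numeral_2_eq_2)
  have "2 * j - 2 \<le> i"
  proof (rule ccontr)
    assume "\<not> 2 * j - 2 \<le> i"
    moreover have "2 * j - 2 \<le> 2 * l + 1" using assms(1) by auto
    ultimately show False using pt_less[of i "2 * j - 2"] x i by simp
  qed
  moreover have "i \<le> 2 * j - 1"
  proof (rule ccontr)
    assume "\<not> i \<le> 2 * j - 1"
    then show False using pt_less[of "2 * j - 1" i] x i by simp
  qed
  ultimately have "i = 2 * j - 2 \<or> i = 2 * j - 1" by linarith
  with i that show thesis by auto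
qed

lemma asc_mem_cases:
  assumes "j \<in> {1..l + 1}" "x \<in> seg \<beta> (2 * j - 1)"
  obtains "x \<in> unshared_asc \<beta> j" | "2 \<le> j" "x = pt \<beta> (2 * j - 2)" | "j \<le> l" "x = pt \<beta> (2 * j - 1)"
proof (cases "shared \<beta> x")
  case True
  show thesis by (rule shared_asc_cases[OF assms True]) (fact that)+
next
  case False
  then show thesis using assms(2) that(1) by (simp add: unshared_asc_def)
qed

lemma pt_mem_desc:
  assumes "i \<in> {1..l}"
  shows "pt \<beta> (2 * i - 1) \<in> desc \<beta> i" "pt \<beta> (2 * i) \<in> desc \<beta> i"
proof -
  have "2 * i - 1 \<le> 2 * l" "Suc (2 * i - 1) = 2 * i" "1 \<le> 2 * i" "2 * i \<le> 2 * l + 1"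
    using assms by auto
  then show "pt \<beta> (2 * i - 1) \<in> desc \<beta> i" "pt \<beta> (2 * i) \<in> desc \<beta> i"
    using pt_mem_seg(1)[of "2 * i"] pt_mem_seg(2)[of "2 * i - 1"] unfolding desc_def by metis+
qed

lemma desc_bounds:
  assumes "x \<in> desc \<beta> i"
  shows "pt \<beta> (2 * i - 1) \<le> x" "x \<le> pt \<beta> (2 * i)"
  using assms unfolding desc_def seg_def by simp_all

lemma two_le_card_desc: "\<forall>i\<in>{1..ell \<beta>}. 2 \<le> card (desc \<beta> i)"
proof
  fix i assume i: "i \<in> {1..ell \<beta>}"
  have "card {pt \<beta> (2 * i - 1), pt \<beta> (2 * i)} = 2"
    using pt_less[of "2 * i - 1" "2 * i"] i by simp
  moreover have "{pt \<beta> (2 * i - 1), pt \<beta> (2 * i)} \<subseteq> desc \<beta> i"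
    using pt_mem_desc[of i] i by simp
  ultimately show "2 \<le> card (desc \<beta> i)"
    by (metis card_mono finite_desc)
qed

text \<open>A shared element of ascending segment \<open>j\<close> is one of its ends: the left end
  is the bottom of descending segment \<open>j - 1\<close>, the right end the top of descending
  segment \<open>j\<close>.\<close>

lemma fence_eq: "fence \<beta> = (\<Union>j\<in>{1..l + 1}. unshared_asc \<beta> j) \<union> (\<Union>i\<in>{1..l}. desc \<beta> i)"
proof (rule equalityI; rule subsetI)
  fix x assume "x \<in> fence \<beta>"
  then obtain s where s: "s \<in> {1..2 * l + 1}" "x \<in> seg \<beta> s" by (auto simp: fence_def len)
  show "x \<in> (\<Union>j\<in>{1..l + 1}. unshared_asc \<beta> j) \<union> (\<Union>i\<in>{1..l}. desc \<beta> i)"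
  proof (cases "even s")
    case True
    then have "x \<in> desc \<beta> (s div 2)" "s div 2 \<in> {1..l}" using s by (auto simp: desc_def elim!: evenE)
    then show ?thesis by blast
  next
    case False
    \<comment> \<open>An odd \<open>s = 2 * m + 1\<close> gives \<open>j = Suc m\<close>.\<close>
    then obtain j where j: "s = 2 * j - 1" "j \<in> {1..l + 1}"
      using s by (auto elim!: oddE intro: that[of "Suc _"])
    from asc_mem_cases[OF j(2) s(2)[unfolded j(1)]] show ?thesis
    proof cases
      case 2
      then have "j - 1 \<in> {1..l}" using j(2) by auto
      then have "x \<in> desc \<beta> (j - 1)" "j - 1 \<in> {1..l}"
        using pt_mem_desc(2)[of "j - 1"] 2 by (auto simp: right_diff_distrib')
      then show ?thesis by blast
    next
      case 3
      then have "x \<in> desc \<beta> j" "j \<in> {1..l}" using pt_mem_desc(1)[of j] j(2) by auto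
      then show ?thesis by blast
    qed (use j in blast)
  qed
next
  fix x assume "x \<in> (\<Union>j\<in>{1..l + 1}. unshared_asc \<beta> j) \<union> (\<Union>i\<in>{1..l}. desc \<beta> i)"
  then consider j where "j \<in> {1..l + 1}" "x \<in> seg \<beta> (2 * j - 1)" | i where "i \<in> {1..l}" "x \<in> seg \<beta> (2 * i)"
    by (auto simp: unshared_asc_def desc_def)
  then show "x \<in> fence \<beta>"
  proof cases
    case 1
    then have "2 * j - 1 \<in> {1..length \<beta>}" by (auto simp: len)
    with 1 show ?thesis unfolding fence_def by blast
  next
    case 2
    then have "2 * i \<in> {1..length \<beta>}" by (auto simp: len)
    with 2 show ?thesis unfolding fence_def by blast
  qed
qed

lemma seg_unique_unshared:
  assumes "x \<in> seg \<beta> s" "x \<in> seg \<beta> t" "s \<in> {1..2 * l + 1}" "t \<in> {1..2 * l + 1}" "\<not> shared \<beta> x"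
  shows "s = t"
  using assms unfolding shared_def len by blast

lemma unshared_asc_disjoint:
  assumes "j \<in> {1..l + 1}" "j' \<in> {1..l + 1}" "x \<in> unshared_asc \<beta> j" "x \<in> unshared_asc \<beta> j'"
  shows "j = j'"
proof -
  have "2 * j - 1 = 2 * j' - 1"
    by (rule seg_unique_unshared[of x]) (use assms in \<open>auto simp: unshared_asc_def\<close>)
  then show ?thesis using assms(1,2) by auto
qed

lemma unshared_asc_desc_disjoint:
  assumes "j \<in> {1..l + 1}" "i \<in> {1..l}" "x \<in> unshared_asc \<beta> j"
  shows "x \<notin> desc \<beta> i"
proof
  assume "x \<in> desc \<beta> i"
  then have "2 * j - 1 = 2 * i"
    by (intro seg_unique_unshared[of x]) (use assms in \<open>auto simp: unshared_asc_def desc_def\<close>)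
  moreover have "1 \<le> j" using assms(1) by simp
  ultimately show False by presburger
qed

text \<open>Distinct segments with a common point have consecutive indices, but two even indices are
  never consecutive.\<close>

lemma desc_disjoint:
  assumes "i \<in> {1..l}" "i' \<in> {1..l}" "x \<in> desc \<beta> i" "x \<in> desc \<beta> i'"
  shows "i = i'"
proof -
  have False if "i < i'" "i \<in> {1..l}" "i' \<in> {1..l}" "x \<in> seg \<beta> (2 * i)" "x \<in> seg \<beta> (2 * i')" for i i'
  proof -
    have "2 * i' = Suc (2 * i)"
      by (rule seg_inter(1)[OF pos _ _ _ that(4,5)]) (use that len in auto)
    then show False by presburger
  qed
  with assms show ?thesis unfolding desc_def by (metis linorder_neqE_nat)
qed

section \<open>Encodings of ideals and filters\<close>

lemma card_eq_code_size:
  assumes "X \<subseteq> fence \<beta>"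
  shows "card X = code_size \<beta> (fst (encode \<beta> X)) (snd (encode \<beta> X))"
proof -
  have fin: "finite X" using assms finite_fence by (rule finite_subset)
  have "X = (\<Union>j\<in>{1..l + 1}. X \<inter> unshared_asc \<beta> j) \<union> (\<Union>i\<in>{1..l}. X \<inter> desc \<beta> i)"
    using assms unfolding fence_eq by blast
  moreover have "(\<Union>j\<in>{1..l + 1}. X \<inter> unshared_asc \<beta> j) \<inter> (\<Union>i\<in>{1..l}. X \<inter> desc \<beta> i) = {}"
    using unshared_asc_desc_disjoint by blast
  ultimately have "card X = card (\<Union>j\<in>{1..l + 1}. X \<inter> unshared_asc \<beta> j) + card (\<Union>i\<in>{1..l}. X \<inter> desc \<beta> i)"
    using fin by (metis card_Un_disjoint finite_Un)
  also have "card (\<Union>j\<in>{1..l + 1}. X \<inter> unshared_asc \<beta> j) = (\<Sum>j\<in>{1..l + 1}. card (X \<inter> unshared_asc \<beta> j))"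
    using fin unshared_asc_disjoint by (intro card_UN_disjoint) blast+
  also have "card (\<Union>i\<in>{1..l}. X \<inter> desc \<beta> i) = (\<Sum>i\<in>{1..l}. card (X \<inter> desc \<beta> i))"
    using fin desc_disjoint by (intro card_UN_disjoint) blast+
  finally show ?thesis by (simp add: code_size_def encode_def)
qed

lemma asc_order:
  assumes "j \<in> {1..l + 1}" "x \<in> seg \<beta> (2 * j - 1)" "y \<in> seg \<beta> (2 * j - 1)" "x \<le> y"
  shows "(x, y) \<in> fence_order \<beta>"
proof -
  have "2 * j - 1 \<in> {1..length \<beta>}" "odd (2 * j - 1)" using assms(1) len by auto
  moreover have "if odd (2 * j - 1) then x \<le> y else y \<le> x" using assms(4) calculation(2) by presburger
  ultimately show ?thesis using assms(2,3) unfolding fence_order_def by blast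
qed

text \<open>On a chain the traces of two ideals, or of two filters, are nested, so equal sizes make
  them equal; the pieces counted by the code lie in segments and cover the fence.\<close>

lemma eq_if_same_code:
  assumes ideals: "lower_ideal \<beta> X \<and> lower_ideal \<beta> Y \<or> upper_ideal \<beta> X \<and> upper_ideal \<beta> Y"
    and code: "codes_agree \<beta> (encode \<beta> X) (encode \<beta> Y)"
  shows "X = Y"
proof -
  have piece: "X \<inter> C = Y \<inter> C"
    if C: "C \<subseteq> seg \<beta> s" "s \<in> {1..length \<beta>}" and card: "card (X \<inter> C) = card (Y \<inter> C)" for C s
  proof -
    have fin: "finite C" using C(1) finite_seg by (rule finite_subset)
    have "X \<inter> C \<subseteq> Y \<inter> C \<or> Y \<inter> C \<subseteq> X \<inter> C"
    proof (rule ccontr)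
      assume "\<not> ?thesis"
      then obtain x y where xy: "x \<in> X" "x \<in> C" "x \<notin> Y" "y \<in> Y" "y \<in> C" "y \<notin> X" by blast
      then have "(x, y) \<in> fence_order \<beta> \<or> (y, x) \<in> fence_order \<beta>"
        using C seg_total by blast
      with ideals xy lower_idealD upper_idealD show False by metis
    qed
    then show ?thesis
      using card fin by (metis card_subset_eq finite_Int)
  qed
  have "X \<subseteq> fence \<beta>" "Y \<subseteq> fence \<beta>"
    using ideals by (auto simp: lower_ideal_def upper_ideal_def)
  moreover have "X \<inter> unshared_asc \<beta> j = Y \<inter> unshared_asc \<beta> j" if "j \<in> {1..l + 1}" for j
    using code that
    by (intro piece[of _ "2 * j - 1"]) (auto simp: unshared_asc_def len codes_agree_def encode_def)
  moreover have "X \<inter> desc \<beta> i = Y \<inter> desc \<beta> i" if "i \<in> {1..l}" for i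
    using code that
    by (intro piece[of _ "2 * i"]) (auto simp: desc_def len codes_agree_def encode_def)
  ultimately show ?thesis unfolding fence_eq by blast
qed

lemma ideal_code_encode:
  assumes I: "lower_ideal \<beta> I"
  shows "ideal_code \<beta> (fst (encode \<beta> I)) (snd (encode \<beta> I))"
proof -
  have a_le: "card (I \<inter> unshared_asc \<beta> j) \<le> alpha \<beta> j - 1" for j
    by (simp add: alpha_def card_mono)
  have d_le: "card (I \<inter> desc \<beta> i) \<le> card (desc \<beta> i)" for i
    by (simp add: card_mono)
  \<comment> \<open>An element of \<open>I\<close> on an ascending segment forces the minimum of
    that segment into \<open>I\<close>, and this minimum \<open>pt \<beta> (2 * i)\<close> is the
    bottom of descending segment \<open>i\<close>.\<close>
  have d_pos: "0 < card (I \<inter> desc \<beta> i)"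
    if i: "i \<in> {1..l}" and x: "x \<in> I" "x \<in> seg \<beta> (2 * (i + 1) - 1)" for x i
  proof -
    have "pt \<beta> (2 * i) \<in> seg \<beta> (2 * (i + 1) - 1)"
      using pt_mem_seg(2)[of "2 * i"] i by simp
    moreover have "pt \<beta> (2 * i) \<le> x" using x by (simp add: seg_def)
    ultimately have "(pt \<beta> (2 * i), x) \<in> fence_order \<beta>"
      using asc_order[of "i + 1"] i x by simp
    then have "pt \<beta> (2 * i) \<in> I \<inter> desc \<beta> i"
      using lower_idealD[OF I] x pt_mem_desc[OF i] by blast
    then show ?thesis by (metis card_gt_0_iff empty_iff finite_Int finite_desc)
  qed
  have "0 < card (I \<inter> desc \<beta> i)" if "0 < card (I \<inter> unshared_asc \<beta> (i + 1))" "i \<in> {1..l}" for i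
  proof -
    have "I \<inter> unshared_asc \<beta> (i + 1) \<noteq> {}"
      using that(1) card_gt_0_iff by blast
    then obtain x where "x \<in> I" "x \<in> unshared_asc \<beta> (i + 1)" by blast
    then show ?thesis using d_pos[OF that(2), of x] by (auto simp: unshared_asc_def)
  qed
  moreover have "card (I \<inter> unshared_asc \<beta> i) = alpha \<beta> i - 1 \<and> (2 \<le> i \<longrightarrow> 0 < card (I \<inter> desc \<beta> (i - 1)))"
    if full: "card (I \<inter> desc \<beta> i) = card (desc \<beta> i)" and i: "i \<in> {1..l}" for i
  proof -
    have "I \<inter> desc \<beta> i = desc \<beta> i"
      using full by (intro card_subset_eq) auto
    then have top: "pt \<beta> (2 * i - 1) \<in> I" using pt_mem_desc[OF i] by blast
    have "x \<in> I" if "x \<in> seg \<beta> (2 * i - 1)" for x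
    proof -
      have "x \<le> pt \<beta> (2 * i - 1)" using that by (simp add: seg_def)
      then have "(x, pt \<beta> (2 * i - 1)) \<in> fence_order \<beta>"
        using asc_order[of i x] that i pt_mem_seg(1)[of "2 * i - 1"] by auto
      then show ?thesis using lower_idealD[OF I] top by blast
    qed
    then have "I \<inter> unshared_asc \<beta> i = unshared_asc \<beta> i" by (auto simp: unshared_asc_def)
    \<comment> \<open>The top found above lies on ascending segment \<open>i = (i - 1) + 1\<close>,
      so \<open>d_pos\<close> applies at \<open>i - 1\<close>.\<close>
    moreover have "0 < card (I \<inter> desc \<beta> (i - 1))" if "2 \<le> i"
    proof (rule d_pos[OF _ top])
      show "i - 1 \<in> {1..l}" using that i by auto
      show "pt \<beta> (2 * i - 1) \<in> seg \<beta> (2 * (i - 1 + 1) - 1)"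
        using pt_mem_seg(1)[of "2 * i - 1"] i by auto
    qed
    ultimately show ?thesis by (simp add: alpha_def)
  qed
  ultimately show ?thesis
    using a_le d_le by (simp add: ideal_code_def encode_def)
qed

text \<open>Choose an upper part of the right size in each cell of the partition. Only passages
  between cells remain: climbing to the glued top of an ascending segment is covered by positivity
  of \<open>e j\<close>, and starting at its glued bottom by the clause on full descending
  segments.\<close>

lemma ex_upper_ideal_encoded:
  assumes fc: "filter_code \<beta> b e"
  shows "\<exists>U. upper_ideal \<beta> U \<and> encoded_by \<beta> U (b, e)"
proof -
  have "\<exists>X\<subseteq>unshared_asc \<beta> j. card X = b j \<and> (\<forall>x\<in>X. \<forall>y\<in>unshared_asc \<beta> j. x \<le> y \<longrightarrow> y \<in> X)"
    if "j \<in> {1..l + 1}" for j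
    using fc that by (intro ex_final_subset) (auto simp: filter_code_def alpha_def)
  then obtain B where B: "\<And>j. j \<in> {1..l + 1} \<Longrightarrow> B j \<subseteq> unshared_asc \<beta> j \<and> card (B j) = b j \<and>
      (\<forall>x\<in>B j. \<forall>y\<in>unshared_asc \<beta> j. x \<le> y \<longrightarrow> y \<in> B j)" by metis
  have "\<exists>X\<subseteq>desc \<beta> i. card X = e i \<and> (\<forall>x\<in>X. \<forall>y\<in>desc \<beta> i. y \<le> x \<longrightarrow> y \<in> X)"
    if "i \<in> {1..l}" for i
    using fc that by (intro ex_initial_subset) (auto simp: filter_code_def)
  then obtain E where E: "\<And>i. i \<in> {1..l} \<Longrightarrow> E i \<subseteq> desc \<beta> i \<and> card (E i) = e i \<and>
      (\<forall>x\<in>E i. \<forall>y\<in>desc \<beta> i. y \<le> x \<longrightarrow> y \<in> E i)" by metis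
  define U where "U = (\<Union>j\<in>{1..l + 1}. B j) \<union> (\<Union>i\<in>{1..l}. E i)"
  have UB: "U \<inter> unshared_asc \<beta> j = B j" if j: "j \<in> {1..l + 1}" for j
  proof
    show "U \<inter> unshared_asc \<beta> j \<subseteq> B j"
    proof
      fix x assume x: "x \<in> U \<inter> unshared_asc \<beta> j"
      then consider j' where "j' \<in> {1..l + 1}" "x \<in> B j'" | i where "i \<in> {1..l}" "x \<in> E i"
        unfolding U_def by blast
      then show "x \<in> B j"
      proof cases
        case 1
        then have "x \<in> unshared_asc \<beta> j'" using B by blast
        with 1 x j show ?thesis using unshared_asc_disjoint by blast
      next
        case 2
        then show ?thesis using E x j unshared_asc_desc_disjoint by blast
      qed
    qed
  qed (use B[OF j] j in \<open>auto simp: U_def\<close>)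
  have UE: "U \<inter> desc \<beta> i = E i" if i: "i \<in> {1..l}" for i
  proof
    show "U \<inter> desc \<beta> i \<subseteq> E i"
    proof
      fix x assume x: "x \<in> U \<inter> desc \<beta> i"
      then consider j where "j \<in> {1..l + 1}" "x \<in> B j" | i' where "i' \<in> {1..l}" "x \<in> E i'"
        unfolding U_def by blast
      then show "x \<in> E i"
      proof cases
        case 1
        then show ?thesis using B x i unshared_asc_desc_disjoint by blast
      next
        case 2
        then have "x \<in> desc \<beta> i'" using E by blast
        with 2 x i show ?thesis using desc_disjoint by blast
      qed
    qed
  qed (use E[OF i] i in \<open>auto simp: U_def\<close>)
  \<comment> \<open>A nonempty initial subset of a descending segment contains its leftmost element,
    which is its top.\<close>
  have top: "pt \<beta> (2 * i - 1) \<in> U" if i: "i \<in> {1..l}" and "0 < e i" for i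
  proof -
    have "0 < card (E i)" using that E[OF i] by simp
    then have "E i \<noteq> {}" using card_gt_0_iff by blast
    then obtain x where "x \<in> E i" by blast
    moreover from this have "pt \<beta> (2 * i - 1) \<le> x"
      using E[OF i] by (intro desc_bounds(1)) blast
    ultimately have "pt \<beta> (2 * i - 1) \<in> E i"
      using E[OF i] pt_mem_desc(1)[OF i] by blast
    then show ?thesis using UE[OF i] by blast
  qed
  have "y \<in> U" if xy: "(x, y) \<in> fence_order \<beta>" and x: "x \<in> U" for x y
  proof -
    obtain s where s: "s \<in> {1..2 * l + 1}" "x \<in> seg \<beta> s" "y \<in> seg \<beta> s" "if odd s then x \<le> y else y \<le> x"
      using xy by (auto simp: fence_order_def len)
    show ?thesis
    proof (cases "even s")
      case True
      then obtain i where i: "s = 2 * i" by (elim evenE)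
      then have i': "i \<in> {1..l}" "x \<in> desc \<beta> i" "y \<in> desc \<beta> i" "y \<le> x"
        using s True by (auto simp: desc_def)
      then have "y \<in> E i" using x UE[of i] E[of i] by blast
      then show ?thesis using UE[of i] i' by blast
    next
      case False
      then obtain j where j: "s = 2 * j - 1" "j \<in> {1..l + 1}"
        using s by (auto elim!: oddE intro: that[of "Suc _"])
      have le: "x \<le> y" and xs: "x \<in> seg \<beta> (2 * j - 1)" and ys: "y \<in> seg \<beta> (2 * j - 1)"
        using s j False by auto
      have low: "pt \<beta> (2 * j - 2) \<le> x" "x \<le> pt \<beta> (2 * j - 1)"
        using xs by (auto simp: seg_def numeral_2_eq_2)
      have b_pos: "0 < e j" if "j \<le> l" "0 < b j"
        using fc that j(2) by (auto simp: filter_code_def)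
      from asc_mem_cases[OF j(2) xs] show ?thesis
      proof cases
        case 1
        then have xB: "x \<in> B j" using x UB[OF j(2)] by blast
        from asc_mem_cases[OF j(2) ys] show ?thesis
        proof cases
          case 1
          then have "y \<in> B j" using B[OF j(2)] xB le by blast
          then show ?thesis using UB[OF j(2)] by blast
        next
          case 2
          \<comment> \<open>Here \<open>y\<close> is the minimum of the segment, so
            \<open>y = x\<close>.\<close>
          then show ?thesis using low le x by simp
        next
          case 3
          have "0 < b j"
            using xB B[OF j(2)] finite_subset[OF _ finite_unshared_asc] card_gt_0_iff[of "B j"]
            by (metis empty_iff)
          then show ?thesis using top[of j] b_pos 3 j(2) by simp
        qed
      next
        case 2
        define i where "i = j - 1"
        have i: "i \<in> {1..l}" "j = i + 1" "x = pt \<beta> (2 * i)"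
          using 2 j(2) by (auto simp: i_def right_diff_distrib')
        have "x \<in> E i" using UE[OF i(1)] pt_mem_desc(2)[OF i(1)] i(3) x by blast
        \<comment> \<open>The chosen part is initial and contains the rightmost element, so it is
          the whole segment.\<close>
        then have "E i = desc \<beta> i" using E[OF i(1)] desc_bounds(2)[of _ i] i(3) by blast
        then have "e i = card (desc \<beta> i)" using E[OF i(1)] by metis
        then have full: "b j = alpha \<beta> j - 1" "j \<le> l \<Longrightarrow> 0 < e j"
          using fc i by (auto simp: filter_code_def)
        have Bj: "B j = unshared_asc \<beta> j"
          using B[OF j(2)] full(1) by (intro card_subset_eq) (auto simp: alpha_def)
        from asc_mem_cases[OF j(2) ys] show ?thesis
        proof cases
          case 1
          then show ?thesis using UB[OF j(2)] Bj by blast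
        next
          case 2
          then show ?thesis using low le x by simp
        next
          case 3
          then show ?thesis using top[of j] full(2) j(2) by simp
        qed
      next
        case 3
        have "y \<le> pt \<beta> (2 * j - 1)" using ys by (simp add: seg_def)
        with 3 le have "y = x" by simp
        with x show ?thesis by simp
      qed
    qed
  qed
  moreover have "U \<subseteq> fence \<beta>"
    unfolding U_def fence_eq by (intro Un_mono UN_mono order_refl) (use B E in blast)+
  ultimately have "upper_ideal \<beta> U" by (auto simp: upper_ideal_def)
  moreover have "encoded_by \<beta> U (b, e)"
    using UB UE B E by (simp add: encoded_by_def encode_def)
  ultimately show ?thesis by blast
qed

text \<open>Positions left of the first peak lie on the first segment only. This turns the bound on
  \<open>k\<close> into one in terms of \<open>alpha\<close>.\<close>

lemma hd_le_alpha:
  assumes "0 < l"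
  shows "hd \<beta> \<le> alpha \<beta> 1 - 1"
proof -
  have "\<beta> \<noteq> []" using len by auto
  then have p1: "pt \<beta> 1 = hd \<beta>" by (cases \<beta>) auto
  have "{..<pt \<beta> 1} \<subseteq> unshared_asc \<beta> 1"
  proof
    fix x assume x: "x \<in> {..<pt \<beta> 1}"
    then have "x \<in> seg \<beta> (2 * 1 - 1)" by (simp add: seg_def)
    then show "x \<in> unshared_asc \<beta> 1"
      by (rule asc_mem_cases[rotated]) (use x in auto)
  qed
  then have "card {..<pt \<beta> 1} \<le> card (unshared_asc \<beta> 1)" by (intro card_mono) auto
  then show ?thesis unfolding p1 alpha_def by simp
qed

text \<open>The mirror image: positions right of the last valley lie on the last segment
  only.\<close>

lemma last_le_alpha:
  assumes "0 < l"
  shows "last \<beta> \<le> alpha \<beta> (l + 1) - 1"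
proof -
  have "pt \<beta> (2 * l + 1) = pt \<beta> (2 * l) + \<beta> ! (2 * l)"
    using take_Suc_conv_app_nth[of "2 * l" \<beta>] len
    by (metis Suc_eq_plus1 lessI sum_list.Cons sum_list.Nil sum_list_append add_0_right)
  moreover have "\<beta> ! (2 * l) = last \<beta>"
    using len by (subst last_conv_nth) auto
  ultimately have p: "pt \<beta> (2 * l + 1) = pt \<beta> (2 * l) + last \<beta>" by simp
  have "{pt \<beta> (2 * l)<..pt \<beta> (2 * l + 1)} \<subseteq> unshared_asc \<beta> (l + 1)"
  proof
    fix x assume x: "x \<in> {pt \<beta> (2 * l)<..pt \<beta> (2 * l + 1)}"
    then have "x \<in> seg \<beta> (2 * (l + 1) - 1)" by (simp add: seg_def)
    then show "x \<in> unshared_asc \<beta> (l + 1)"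
      by (rule asc_mem_cases[rotated]) (use x in auto)
  qed
  then have "card {pt \<beta> (2 * l)<..pt \<beta> (2 * l + 1)} \<le> card (unshared_asc \<beta> (l + 1))"
    by (intro card_mono) auto
  then show ?thesis unfolding p alpha_def by simp
qed

section \<open>The map \<open>\<Phi>\<close>\<close>

text \<open>One pass through the three steps with the invariants of each stage, on which the later
  facts about \<open>Phi\<close> draw. The bound on \<open>k\<close> enters through
  \<open>hd_le_alpha\<close> and \<open>last_le_alpha\<close>.\<close>

lemma Phi_code_stages:
  assumes I: "I \<in> ideals \<beta> k" and k: "k \<le> min (hd \<beta>) (last \<beta>)"
  obtains a d b e where "PH1 \<beta> (encode \<beta> I) = (a, d)" "reduced_ideal_code \<beta> a d"
    "PH2 \<beta> (a, d) = (b, e)" "reduced_filter_code \<beta> b e" "Phi_code \<beta> I = PH3 \<beta> (b, e)"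
    "filter_code \<beta> (fst (PH3 \<beta> (b, e))) (snd (PH3 \<beta> (b, e)))"
    "code_size \<beta> (fst (PH3 \<beta> (b, e))) (snd (PH3 \<beta> (b, e))) = k"
proof -
  obtain a0 d0 where enc: "encode \<beta> I = (a0, d0)" by fastforce
  obtain a d where PH1: "PH1 \<beta> (a0, d0) = (a, d)" by fastforce
  obtain b e where PH2: "PH2 \<beta> (a, d) = (b, e)" by fastforce
  obtain b' e' where PH3: "PH3 \<beta> (b, e) = (b', e')" by fastforce
  have I': "lower_ideal \<beta> I" "card I = k" using I by (auto simp: ideals_def)
  then have size0: "code_size \<beta> a0 d0 = k"
    using card_eq_code_size[of I] enc by (simp add: lower_ideal_def)
  have red: "reduced_ideal_code \<beta> a d"
  proof (rule reduced_ideal_code_PH1[OF _ two_le_card_desc _ _ PH1])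
    show "ideal_code \<beta> a0 d0" using ideal_code_encode[OF I'(1)] enc by simp
    show "code_size \<beta> a0 d0 \<le> alpha \<beta> 1 - 1" "code_size \<beta> a0 d0 \<le> alpha \<beta> (ell \<beta> + 1) - 1" if "0 < ell \<beta>"
      using hd_le_alpha last_le_alpha that k unfolding size0 by auto
  qed
  have red': "reduced_filter_code \<beta> b e"
    using red two_le_card_desc PH2 by (rule reduced_filter_code_PH2)
  have fc: "filter_code \<beta> b' e'"
    using red' two_le_card_desc PH3 by (rule filter_code_PH3)
  have "code_size \<beta> b' e' = k"
    using code_size_PH1[of \<beta> a0 d0] code_size_PH2[OF red PH2] code_size_PH3[of \<beta> b e] size0 PH1 PH3 by simp
  with fc PH3 have "filter_code \<beta> (fst (PH3 \<beta> (b, e))) (snd (PH3 \<beta> (b, e)))"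
    "code_size \<beta> (fst (PH3 \<beta> (b, e))) (snd (PH3 \<beta> (b, e))) = k" by simp_all
  moreover have "Phi_code \<beta> I = PH3 \<beta> (b, e)"
    by (simp add: Phi_code_def enc PH1 PH2)
  ultimately show thesis
    using that PH1 PH2 red red' enc by metis
qed

lemma ex1_upper_ideal_encoded:
  assumes "I \<in> ideals \<beta> k" "k \<le> min (hd \<beta>) (last \<beta>)"
  shows "\<exists>!U. upper_ideal \<beta> U \<and> encoded_by \<beta> U (Phi_code \<beta> I)"
proof (rule ex_ex1I)
  show "\<exists>U. upper_ideal \<beta> U \<and> encoded_by \<beta> U (Phi_code \<beta> I)"
    using Phi_code_stages[OF assms] ex_upper_ideal_encoded by (metis prod.collapse)
  fix U V
  assume "upper_ideal \<beta> U \<and> encoded_by \<beta> U (Phi_code \<beta> I)" "upper_ideal \<beta> V \<and> encoded_by \<beta> V (Phi_code \<beta> I)"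
  then show "U = V"
    by (intro eq_if_same_code) (auto simp: encoded_by_def codes_agree_def)
qed

lemma Phi_encoded:
  assumes "I \<in> ideals \<beta> k" "k \<le> min (hd \<beta>) (last \<beta>)"
  shows "upper_ideal \<beta> (Phi \<beta> I)" "encoded_by \<beta> (Phi \<beta> I) (Phi_code \<beta> I)"
  using theI'[OF ex1_upper_ideal_encoded[OF assms]] unfolding Phi_def by auto

lemma Phi_defined_ideals:
  assumes "I \<in> ideals \<beta> k" "k \<le> min (hd \<beta>) (last \<beta>)"
  shows "Phi_defined \<beta> I"
proof -
  obtain a d where PH1: "PH1 \<beta> (encode \<beta> I) = (a, d)" and red: "reduced_ideal_code \<beta> a d"
    using Phi_code_stages[OF assms] by metis
  let ?C = "\<lambda>i. a i < alpha \<beta> i - 1"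
  have F: "PH2_factors \<beta> (a, d) = map (map d) (factors ?C [1..<ell \<beta> + 1])"
    by (simp add: PH2_factors_def)
  have "\<forall>xs\<in>set (PH2_factors \<beta> (a, d)). phi_applicable xs"
    using phi_applicable_factors[OF _ cut_safe_reduced[OF red]] unfolding F by auto
  moreover have "length (concat (map phi (PH2_factors \<beta> (a, d)))) = ell \<beta>"
    using length_phi_factors[OF _ cut_safe_reduced[OF red]] unfolding F phi_factors_def by simp
  ultimately show ?thesis
    using ex1_upper_ideal_encoded[OF assms] unfolding Phi_defined_def PH1 by blast
qed

lemma Phi_in_filters:
  assumes "I \<in> ideals \<beta> k" "k \<le> min (hd \<beta>) (last \<beta>)"
  shows "Phi \<beta> I \<in> filters \<beta> k"
proof -
  have "Phi \<beta> I \<subseteq> fence \<beta>" using Phi_encoded(1)[OF assms] by (simp add: upper_ideal_def)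
  then have "card (Phi \<beta> I) = code_size \<beta> (fst (encode \<beta> (Phi \<beta> I))) (snd (encode \<beta> (Phi \<beta> I)))"
    by (rule card_eq_code_size)
  also have "\<dots> = code_size \<beta> (fst (Phi_code \<beta> I)) (snd (Phi_code \<beta> I))"
    using Phi_encoded(2)[OF assms] unfolding code_size_def encoded_by_def by simp
  also have "\<dots> = k"
    using Phi_code_stages[OF assms] by metis
  finally show ?thesis
    using Phi_encoded(1)[OF assms] by (simp add: filters_def)
qed

lemma inj_on_Phi:
  assumes k: "k \<le> min (hd \<beta>) (last \<beta>)"
  shows "inj_on (Phi \<beta>) (ideals \<beta> k)"
proof (rule inj_onI)
  fix I J
  assume I: "I \<in> ideals \<beta> k" and J: "J \<in> ideals \<beta> k" and eq: "Phi \<beta> I = Phi \<beta> J"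
  obtain a d b e where s: "PH1 \<beta> (encode \<beta> I) = (a, d)" "reduced_ideal_code \<beta> a d"
    "PH2 \<beta> (a, d) = (b, e)" "reduced_filter_code \<beta> b e" "Phi_code \<beta> I = PH3 \<beta> (b, e)"
    using Phi_code_stages[OF I k] by metis
  obtain a' d' b' e' where s': "PH1 \<beta> (encode \<beta> J) = (a', d')" "reduced_ideal_code \<beta> a' d'"
    "PH2 \<beta> (a', d') = (b', e')" "reduced_filter_code \<beta> b' e'" "Phi_code \<beta> J = PH3 \<beta> (b', e')"
    using Phi_code_stages[OF J k] by metis
  have "codes_agree \<beta> (PH3 \<beta> (b, e)) (PH3 \<beta> (b', e'))"
    using Phi_encoded(2)[OF I k] Phi_encoded(2)[OF J k] unfolding eq s(5) s'(5)
    by (auto simp: encoded_by_def codes_agree_def)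
  then have "codes_agree \<beta> (PH2 \<beta> (a, d)) (PH2 \<beta> (a', d'))"
    unfolding s(3) s'(3) by (rule PH3_inject[OF s(4) s'(4)])
  then have "codes_agree \<beta> (PH1 \<beta> (encode \<beta> I)) (PH1 \<beta> (encode \<beta> J))"
    unfolding s(1) s'(1) by (rule PH2_inject[OF s(2) s'(2)])
  moreover have li: "lower_ideal \<beta> I" "lower_ideal \<beta> J" using I J by (auto simp: ideals_def)
  ultimately have "codes_agree \<beta> (encode \<beta> I) (encode \<beta> J)"
    using PH1_inject[OF ideal_code_encode[OF li(1)] ideal_code_encode[OF li(2)]] by simp
  with li show "I = J" by (intro eq_if_same_code) auto
qed

section \<open>Finiteness and rotation of the fence\<close>

lemma finite_filters: "finite (filters \<beta> k)"
  by (rule finite_subset[of _ "Pow (fence \<beta>)"]) (auto simp: filters_def upper_ideal_def)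

lemma finite_ideals: "finite (ideals \<beta> k)"
  by (rule finite_subset[of _ "Pow (fence \<beta>)"]) (auto simp: ideals_def lower_ideal_def)

lemma odd_composition_rev: "odd_composition (rev \<beta>) l"
  using pos len by unfold_locales auto

text \<open>An initial sum of the reversed composition is the total minus an initial sum of the
  original one, so reflecting positions exchanges the two ends of the segments.\<close>

lemma seg_rev:
  assumes "s \<in> {1..2 * l + 1}" "x \<in> seg \<beta> s"
  shows "sum_list \<beta> - x \<in> seg (rev \<beta>) (2 * l + 2 - s)"
proof -
  have split: "sum_list \<beta> = pt \<beta> i + sum_list (drop i \<beta>)" for i
    by (metis append_take_drop_id sum_list_append)
  have "pt (rev \<beta>) (2 * l + 1 - i) = sum_list \<beta> - pt \<beta> i" if "i \<le> 2 * l + 1" for i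
  proof -
    have "take (2 * l + 1 - i) (rev \<beta>) = rev (drop i \<beta>)"
      using that len by (simp add: take_rev)
    then show ?thesis using split[of i] by simp
  qed
  from this[of s] this[of "s - 1"] assms show ?thesis
    by (auto simp: seg_def Suc_diff_le)
qed

lemma fence_le:
  assumes "x \<in> fence \<beta>"
  shows "x \<le> sum_list \<beta>"
proof -
  obtain s where "x \<le> pt \<beta> s" using assms by (auto simp: fence_def seg_def)
  also have "pt \<beta> s \<le> sum_list \<beta>"
    using sum_list_append[of "take s \<beta>" "drop s \<beta>"] by simp
  finally show ?thesis .
qed

lemma fence_rev:
  assumes "x \<in> fence \<beta>"
  shows "sum_list \<beta> - x \<in> fence (rev \<beta>)"
proof -
  obtain s where s: "s \<in> {1..2 * l + 1}" "x \<in> seg \<beta> s"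
    using assms by (auto simp: fence_def len)
  have "2 * l + 2 - s \<in> {1..length (rev \<beta>)}" using s(1) len by auto
  then show ?thesis using seg_rev[OF s] unfolding fence_def by blast
qed

text \<open>Since \<open>2 * l + 2\<close> is even, segments \<open>s\<close> and
  \<open>2 * l + 2 - s\<close> are of the same type; positions are reversed, hence so is the
  order.\<close>

lemma fence_order_rev:
  assumes "(x, y) \<in> fence_order \<beta>"
  shows "(sum_list \<beta> - y, sum_list \<beta> - x) \<in> fence_order (rev \<beta>)"
proof -
  obtain s where s: "s \<in> {1..2 * l + 1}" "x \<in> seg \<beta> s" "y \<in> seg \<beta> s" "if odd s then x \<le> y else y \<le> x"
    using assms by (auto simp: fence_order_def len)
  have "2 * l + 2 - s \<in> {1..length (rev \<beta>)}" "odd (2 * l + 2 - s) \<longleftrightarrow> odd s" using s(1) len by auto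
  moreover have "if odd (2 * l + 2 - s) then sum_list \<beta> - y \<le> sum_list \<beta> - x else sum_list \<beta> - x \<le> sum_list \<beta> - y"
    using s(4) unfolding calculation(2) by (auto split: if_splits)
  ultimately show ?thesis
    using seg_rev[OF s(1,2)] seg_rev[OF s(1,3)] unfolding fence_order_def by blast
qed

lemma fence_order_fence: "(x, y) \<in> fence_order \<beta> \<Longrightarrow> x \<in> fence \<beta> \<and> y \<in> fence \<beta>"
  by (auto simp: fence_order_def fence_def)

text \<open>Positions on the fence are at most \<open>sum_list \<beta>\<close>, so the natural
  subtraction is never truncated and reflecting twice is the identity.\<close>

lemma inj_on_reflect: "inj_on (\<lambda>x. sum_list \<beta> - x) (fence \<beta>)"
  by (rule inj_onI) (metis diff_diff_cancel fence_le)

interpretation rev: odd_composition "rev \<beta>" l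
  by (rule odd_composition_rev)

lemma fence_order_rev':
  assumes "(x, y) \<in> fence_order (rev \<beta>)"
  shows "(sum_list \<beta> - y, sum_list \<beta> - x) \<in> fence_order \<beta>" "x \<le> sum_list \<beta>" "y \<le> sum_list \<beta>"
proof -
  have "sum_list (rev \<beta>) = sum_list \<beta>" by simp
  then show "(sum_list \<beta> - y, sum_list \<beta> - x) \<in> fence_order \<beta>" "x \<le> sum_list \<beta>" "y \<le> sum_list \<beta>"
    using rev.fence_order_rev[OF assms] rev.fence_order_fence[OF assms] rev.fence_le by (metis rev_rev_ident)+
qed

lemma reflect_filter:
  assumes "U \<in> filters \<beta> k"
  shows "(\<lambda>x. sum_list \<beta> - x) ` U \<in> ideals (rev \<beta>) k"
proof -
  have U: "upper_ideal \<beta> U" "card U = k" "U \<subseteq> fence \<beta>"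
    using assms by (auto simp: filters_def upper_ideal_def)
  have "inj_on (\<lambda>x. sum_list \<beta> - x) U"
    using inj_on_reflect U(3) by (rule inj_on_subset)
  then have "card ((\<lambda>x. sum_list \<beta> - x) ` U) = k" using U(2) by (simp add: card_image)
  moreover have "x \<in> (\<lambda>x. sum_list \<beta> - x) ` U"
    if xy: "(x, y) \<in> fence_order (rev \<beta>)" and y: "y \<in> (\<lambda>x. sum_list \<beta> - x) ` U" for x y
  proof -
    have "sum_list \<beta> - y \<in> U" using y U(3) fence_le by auto
    then have "sum_list \<beta> - x \<in> U"
      using upper_idealD[OF U(1) fence_order_rev'(1)[OF xy]] by blast
    moreover have "x = sum_list \<beta> - (sum_list \<beta> - x)" using fence_order_rev'(2)[OF xy] by simp
    ultimately show ?thesis by blast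
  qed
  moreover have "(\<lambda>x. sum_list \<beta> - x) ` U \<subseteq> fence (rev \<beta>)" using U(3) fence_rev by blast
  ultimately show ?thesis unfolding ideals_def lower_ideal_def by blast
qed

lemma card_filters_le: "card (filters \<beta> k) \<le> card (ideals (rev \<beta>) k)"
proof (rule card_inj_on_le[of "(`) (\<lambda>x. sum_list \<beta> - x)"])
  show "inj_on ((`) (\<lambda>x. sum_list \<beta> - x)) (filters \<beta> k)"
    by (rule inj_on_subset[OF inj_on_image_Pow[OF inj_on_reflect]]) (auto simp: filters_def upper_ideal_def)
  show "(`) (\<lambda>x. sum_list \<beta> - x) ` filters \<beta> k \<subseteq> ideals (rev \<beta>) k"
    using reflect_filter by blast
  show "finite (ideals (rev \<beta>) k)"
    by (rule rev.finite_ideals)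
qed

lemma card_ideals_le:
  assumes "k \<le> min (hd \<beta>) (last \<beta>)"
  shows "card (ideals \<beta> k) \<le> card (filters \<beta> k)"
proof (rule card_inj_on_le)
  show "inj_on (Phi \<beta>) (ideals \<beta> k)" using assms by (rule inj_on_Phi)
  show "Phi \<beta> ` ideals \<beta> k \<subseteq> filters \<beta> k" using Phi_in_filters[OF _ assms] by blast
  show "finite (filters \<beta> k)" by (rule finite_filters)
qed

end

theorem theorem2p2:
  fixes \<beta> :: "nat list" and l k :: nat
  assumes "\<forall>x\<in>set \<beta>. 0 < x"
    and "length \<beta> = 2 * l + 1"
    and "k \<le> min (hd \<beta>) (last \<beta>)"
  shows "(\<forall>I\<in>ideals \<beta> k. Phi_defined \<beta> I) \<and>
    bij_betw (Phi \<beta>) (ideals \<beta> k) (filters \<beta> k)"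
proof -
  interpret odd_composition \<beta> l using assms by unfold_locales
  interpret rev: odd_composition "rev \<beta>" l by (rule odd_composition_rev)
  have "\<beta> \<noteq> []" using assms(2) by auto
  then have k': "k \<le> min (hd (rev \<beta>)) (last (rev \<beta>))"
    using assms(3) by (simp add: hd_rev last_rev min.commute)
  \<comment> \<open>The chain alternates rotation with the embedding by \<open>Phi\<close> for the
    reversed composition, and returns to \<open>\<beta>\<close> because reversing twice is the
    identity.\<close>
  have "card (filters \<beta> k) \<le> card (ideals (rev \<beta>) k)" by (rule card_filters_le)
  also have "\<dots> \<le> card (filters (rev \<beta>) k)" using k' by (rule rev.card_ideals_le)
  also have "\<dots> \<le> card (ideals \<beta> k)" using rev.card_filters_le by simp
  also have "\<dots> = card (Phi \<beta> ` ideals \<beta> k)" using inj_on_Phi[OF assms(3)] by (simp add: card_image)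
  \<comment> \<open>The image lies in the finite set of filters and has at least as many
    elements.\<close>
  finally have "Phi \<beta> ` ideals \<beta> k = filters \<beta> k"
    by (intro card_seteq finite_filters image_subsetI Phi_in_filters[OF _ assms(3)])
  then show ?thesis
    using inj_on_Phi[OF assms(3)] Phi_defined_ideals[OF _ assms(3)] by (simp add: bij_betw_def)
qed

end
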